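(* Let $d,N\in\mathbb{N}$ and let $f:[0,1)^d\to\mathbb{R}$ be a square-integrable function that is monotone in each coordinate. Denote by $\mu_{\mathcal{P}}$ a randomized quasi-Monte Carlo quadrature based on an RSJ rank-1 lattice (in which case $N$ is assumed to be prime) or on Latin hypercube sampling (LHS), using $N$ integration nodes, and by $\mu^{MC}$ the Monte Carlo quadrature using $N$ integration nodes. Then $$\operatorname{Var}(\mu_{\mathcal{P}}f)\le\operatorname{Var}(\mu^{MC}f).$$
   Context: Quadratures. For a random point set $\mathcal{P}=(p_j)_{j=1}^N$ (here an RSJ rank-1 lattice or an LHS in $[0,1)^d$), $\mu_{\mathcal{P}}f=\frac1N\sum_{j=1}^N f(p_j)$. The Monte Carlo quadrature is $\mu^{MC}f=\frac1N\sum_{j=1}^N f(u_j)$, where $u_1,\dots,u_N$ are independent random points uniformly distributed on the $d$-dimensional unit cube. RSJ rank-1 lattice (randomly shifted and jittered rank-1 lattice). Let $N$ be prime, $\mathbb{F}=\{0,1,\dots,N-1\}$, $\mathbb{F}^*=\mathbb{F}\setminus\{0\}$, $\widetilde{\mathbb{F}}=\frac1N\mathbb{F}$, $\widetilde{\mathbb{F}}^*=\frac1N\mathbb{F}^*$. Let $g$ be uniformly distributed on $(\widetilde{\mathbb{F}}^* )^d$, $S$ uniformly distributed on $\widetilde{\mathbb{F}}^d$, $J_1,\dots,J_N$ each uniformly distributed on $[0,\frac1N)^d$, and $\pi$ a uniformly chosen permutation of $\{1,\dots,N\}$, all of these random variables being independent. Put $y_j=(j-1)g \bmod 1$ and $p_j=y_{\pi(j)}+S+J_j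 \bmod 1$, $j=1,\dots,N$ (all operations componentwise modulo 1). Then $(p_j)_{j=1}^N$ is called an RSJ rank-1 lattice. Latin hypercube sampling. Let $\pi_1,\dots,\pi_d$ be independent uniformly chosen permutations of $\{1,\dots,N\}$ and let $U_j^{(i)}$, $i=1,\dots,d$, $j=1,\dots,N$, be independent random variables uniformly distributed on $[0,1)$, independent also of the permutations. The LHS $(p_j)_{j=1}^N$ is given by the coordinates $p_j^{(i)}=\frac{\pi_i(j)-U_j^{(i)}}{N}$, $i=1,\dots,d$, $j=1,\dots,N$ (these points lie in $[0,1)^d$ almost surely, so $f(p_j)$ is defined almost surely). *)

theory Defs
  imports "HOL-Probability.Probability" "HOL-Combinatorics.Permutations"
begin

definition half_open_cube :: "real \<Rightarrow> (real ^ 'd) set" where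
  "half_open_cube c = {x. \<forall>i. 0 \<le> x $ i \<and> x $ i < c}"

definition square_integrable_on :: "(real ^ 'd) set \<Rightarrow> (real ^ 'd \<Rightarrow> real) \<Rightarrow> bool" where
  "square_integrable_on C f \<longleftrightarrow>
     f \<in> borel_measurable (lebesgue_on C) \<and> integrable (lebesgue_on C) (\<lambda>x. (f x)\<^sup>2)"

text \<open>The direction of monotonicity may differ between coordinates, but for each coordinate it
  is the same whatever the values of the others. If it could vary from line to line, functions
  such as (x - 1/2) * (y - 1/2) would be admitted, for which Latin hypercube sampling has larger
  variance than Monte Carlo.\<close>

definition monotone_in_each_coordinate_on ::
    "(real ^ 'd) set \<Rightarrow> (real ^ 'd \<Rightarrow> real) \<Rightarrow> bool" where
  "monotone_in_each_coordinate_on C f \<longleftrightarrow>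
     (\<forall>i. (\<forall>x\<in>C. \<forall>y\<in>C. (\<forall>k. k \<noteq> i \<longrightarrow> x $ k = y $ k) \<and> x $ i \<le> y $ i \<longrightarrow> f x \<le> f y)
        \<or> (\<forall>x\<in>C. \<forall>y\<in>C. (\<forall>k. k \<noteq> i \<longrightarrow> x $ k = y $ k) \<and> x $ i \<le> y $ i \<longrightarrow> f y \<le> f x))"

definition uniform_finite :: "'w measure \<Rightarrow> 'a set \<Rightarrow> ('w \<Rightarrow> 'a) \<Rightarrow> bool" where
  "uniform_finite M A X \<longleftrightarrow>
     X \<in> M \<rightarrow>\<^sub>M count_space A \<and> distr M (count_space A) X = uniform_count_measure A"

definition uniform_lebesgue ::
    "'w measure \<Rightarrow> 'a::euclidean_space set \<Rightarrow> ('w \<Rightarrow> 'a) \<Rightarrow> bool" where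
  "uniform_lebesgue M A X \<longleftrightarrow>
     X \<in> borel_measurable M \<and> distr M borel X = uniform_measure lborel A"

text \<open>The events determined by a random variable. Independence of random variables with values
  in different types is expressed below by \<open>indep_sets\<close> for these families, which is what
  \<open>indep_vars\<close> means when all value types agree.\<close>

definition rv_events :: "'w measure \<Rightarrow> 'a measure \<Rightarrow> ('w \<Rightarrow> 'a) \<Rightarrow> 'w set set" where
  "rv_events M K X = {X -` A \<inter> space M | A. A \<in> sets K}"

definition permutations :: "nat \<Rightarrow> (nat \<Rightarrow> nat) set" where
  "permutations N = {\<pi>. \<pi> permutes {1..N}}"

definition grid :: "nat \<Rightarrow> (real ^ 'd) set" where
  "grid N = {x. \<forall>i. \<exists>k\<in>{0..<N}. x $ i = real k / real N}"

definition grid_nonzero :: "nat \<Rightarrow> (real ^ 'd) set" where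
  "grid_nonzero N = {x. \<forall>i. \<exists>k\<in>{1..<N}. x $ i = real k / real N}"

definition vec_frac :: "real ^ 'd \<Rightarrow> real ^ 'd" where
  "vec_frac x = (\<chi> i. frac (x $ i))"

definition lattice_point :: "real ^ 'd \<Rightarrow> nat \<Rightarrow> real ^ 'd" where
  "lattice_point g j = vec_frac (real (j - 1) *\<^sub>R g)"

datatype rsj_source = Generator | Shift | Jitter nat | Permutation

definition rsj_lattice ::
    "'w measure \<Rightarrow> nat \<Rightarrow> (nat \<Rightarrow> 'w \<Rightarrow> real ^ 'd) \<Rightarrow> bool" where
  "rsj_lattice M N p \<longleftrightarrow>
     (\<exists>(g :: 'w \<Rightarrow> real ^ 'd) (S :: 'w \<Rightarrow> real ^ 'd)
       (J :: nat \<Rightarrow> 'w \<Rightarrow> real ^ 'd) (\<pi> :: 'w \<Rightarrow> nat \<Rightarrow> nat).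
        uniform_finite M (grid_nonzero N) g \<and>
        uniform_finite M (grid N) S \<and>
        (\<forall>j\<in>{1..N}. uniform_lebesgue M (half_open_cube (1 / real N)) (J j)) \<and>
        uniform_finite M (permutations N) \<pi> \<and>
        prob_space.indep_sets M
          (\<lambda>s. case s of
             Generator \<Rightarrow> rv_events M (count_space (grid_nonzero N)) g
           | Shift \<Rightarrow> rv_events M (count_space (grid N)) S
           | Jitter j \<Rightarrow> rv_events M borel (J j)
           | Permutation \<Rightarrow> rv_events M (count_space (permutations N)) \<pi>)
          ({Generator, Shift, Permutation} \<union> Jitter ` {1..N}) \<and>
        (\<forall>j\<in>{1..N}. \<forall>\<omega>\<in>space M.
           p j \<omega> = vec_frac (lattice_point (g \<omega>) (\<pi> \<omega> j) + S \<omega> + J j \<omega>)))"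

datatype 'd lhs_source = Coord_Permutation 'd | Offset nat 'd

definition latin_hypercube_sample ::
    "'w measure \<Rightarrow> nat \<Rightarrow> (nat \<Rightarrow> 'w \<Rightarrow> real ^ 'd) \<Rightarrow> bool" where
  "latin_hypercube_sample M N p \<longleftrightarrow>
     (\<exists>(\<pi> :: 'd \<Rightarrow> 'w \<Rightarrow> nat \<Rightarrow> nat) (U :: nat \<Rightarrow> 'd \<Rightarrow> 'w \<Rightarrow> real).
        (\<forall>i. uniform_finite M (permutations N) (\<pi> i)) \<and>
        (\<forall>j\<in>{1..N}. \<forall>i. uniform_lebesgue M {0..<1} (U j i)) \<and>
        prob_space.indep_sets M
          (\<lambda>s. case s of
             Coord_Permutation i \<Rightarrow> rv_events M (count_space (permutations N)) (\<pi> i)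
           | Offset j i \<Rightarrow> rv_events M borel (U j i))
          (range Coord_Permutation \<union> {Offset j i | j i. j \<in> {1..N}}) \<and>
        (\<forall>j\<in>{1..N}. \<forall>\<omega>\<in>space M.
           p j \<omega> = (\<chi> i. (real (\<pi> i \<omega> j) - U j i \<omega>) / real N)))"

definition monte_carlo_sample ::
    "'w measure \<Rightarrow> nat \<Rightarrow> (nat \<Rightarrow> 'w \<Rightarrow> real ^ 'd) \<Rightarrow> bool" where
  "monte_carlo_sample M N u \<longleftrightarrow>
     (\<forall>j\<in>{1..N}. uniform_lebesgue M (half_open_cube 1) (u j)) \<and>
     prob_space.indep_vars M (\<lambda>_. borel) u {1..N}"

definition quadrature ::
    "nat \<Rightarrow> (nat \<Rightarrow> 'w \<Rightarrow> real ^ 'd) \<Rightarrow> (real ^ 'd \<Rightarrow> real) \<Rightarrow> 'w \<Rightarrow> real" where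
  "quadrature N p f \<omega> = (1 / real N) * (\<Sum>j=1..N. f (p j \<omega>))"

text \<open>The integrand is only Lebesgue measurable and only constrained on the unit cube, which
  the nodes may leave on a null set. So the quadrature is a random variable on the completed
  probability space; for random variables measurable on \<open>M\<close> itself, the completion does not
  change the variance.\<close>

definition completed_variance :: "'w measure \<Rightarrow> ('w \<Rightarrow> real) \<Rightarrow> real" where
  "completed_variance M X = prob_space.variance (completion M) X"

end

theory Submission
  imports Defs
begin

text \<open>
  Expand the square in the variance of the quadrature: apart from the square of the mean, it is
  \<open>N\<^sup>-\<^sup>2\<close> times the sum of the mixed moments \<open>E (f (p j) * f (p k))\<close>. Every node of the three
  methods is uniformly distributed on the cube, so the means and the diagonal moments agree, and
  an off-diagonal moment of Monte Carlo is the square of the integral of \<open>f\<close>. It remains to see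
  that two different nodes of a lattice or a Latin hypercube sample have a mixed moment that is not
  larger (\<open>separated_pair_negatively_correlated\<close>).

  Cut the cube into \<open>N ^ d\<close> cells of side \<open>1 / N\<close>. Both point sets share one law for a pair of
  different nodes: the pair of their cells is equidistributed among the pairs \<open>(a, b)\<close> that differ
  in every coordinate, and given the cells the two nodes are independent and uniform in them; thus
  \<open>(p j, p k)\<close> is uniformly distributed on \<open>separated_pairs N\<close> (\<open>node_pair_uniform\<close>). For Latin
  hypercube samples this is the symmetry of random permutations. For lattices, put
  \<open>m = \<pi> j - 1\<close> and \<open>n = \<pi> k - 1\<close>: in each coordinate the generator \<open>x \<noteq> 0\<close> and the shift \<open>y\<close>
  give the cells \<open>m x + y\<close> and \<open>n x + y\<close>, and in the field with \<open>N\<close> elements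
  this is a bijection onto the pairs with different entries (\<open>lattice_pair_bij\<close>).

  So the mixed moment is, up to normalisation, the sum of \<open>F a * F b\<close> over the pairs of cells that
  differ in every coordinate, where \<open>F c\<close> is the integral of \<open>f\<close> over the cell \<open>c\<close>. As the cells
  are translates of one another, \<open>F\<close> inherits the monotonicity of \<open>f\<close>. In one coordinate, with
  all others held fixed, Chebyshev's sum inequality says that forbidding \<open>s = t\<close> in a double
  sum of \<open>h s * k t\<close>, where \<open>h\<close> and \<open>k\<close> are monotone in the same direction, removes at least
  \<open>1 / N\<close> times the sum. Treating the coordinates one after the other bounds the sum by
  \<open>(1 - 1 / N) ^ d\<close> times the unrestricted sum (\<open>sum_separated_cells_le\<close>), and this factor is
  exactly the volume of \<open>separated_pairs N\<close> by which the mixed moment is normalised.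

  Since \<open>f\<close> is only Lebesgue measurable, a Borel function \<open>g\<close> that equals \<open>f\<close> almost everywhere
  takes its place in all integrals. It need not be monotone; monotonicity is used for \<open>f\<close>
  and transferred to the cell integrals, so that no section of \<open>f\<close> has to be measurable.
\<close>

section \<open>Separated pairs of grid cells\<close>

definition cells :: "nat \<Rightarrow> ('d::finite \<Rightarrow> nat) set" where
  "cells N = {c. \<forall>i. c i < N}"

definition separated_cells :: "nat \<Rightarrow> (('d::finite \<Rightarrow> nat) \<times> ('d \<Rightarrow> nat)) set" where
  "separated_cells N = {(a, b). a \<in> cells N \<and> b \<in> cells N \<and> (\<forall>i. a i \<noteq> b i)}"

lemma cells_eq_PiE: "cells N = PiE UNIV (\<lambda>_. {..<N})"
  by (auto simp: cells_def PiE_iff)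

lemma finite_cells [simp]: "finite (cells N)"
  by (simp add: cells_eq_PiE finite_PiE)

lemma card_cells: "card (cells N :: ('d::finite \<Rightarrow> nat) set) = N ^ CARD('d)"
  by (simp add: cells_eq_PiE card_PiE)

lemma card_separated_from:
  fixes a :: "'d::finite \<Rightarrow> nat"
  assumes "a \<in> cells N"
  shows "card {b. (a, b) \<in> separated_cells N} = (N - 1) ^ CARD('d)"
proof -
  have "{b. (a, b) \<in> separated_cells N} = PiE UNIV (\<lambda>i. {..<N} - {a i})"
    using assms by (auto simp: separated_cells_def cells_def PiE_iff) metis+
  also have "card \<dots> = (\<Prod>i\<in>UNIV. card ({..<N} - {a i}))"
    by (rule card_PiE) simp
  also have "\<dots> = (N - 1) ^ CARD('d)"
    using assms by (simp add: cells_def card_Diff_singleton)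
  finally show ?thesis .
qed

lemma separated_cells_Sigma:
  "separated_cells N = (SIGMA a:cells N. {b. (a, b) \<in> separated_cells N})"
  by (auto simp: separated_cells_def)

lemma finite_separated_cells [simp]: "finite (separated_cells N)"
  by (rule finite_subset[of _ "cells N \<times> cells N"]) (auto simp: separated_cells_def)

lemma finite_separated_from [simp]: "finite {b. (a, b) \<in> separated_cells N}"
  by (rule finite_subset[of _ "cells N"]) (auto simp: separated_cells_def)

lemma card_separated_cells:
  "card (separated_cells N :: (('d::finite \<Rightarrow> nat) \<times> _) set) = (N * (N - 1)) ^ CARD('d)"
  by (subst separated_cells_Sigma)
     (simp add: card_separated_from card_cells power_mult_distrib)

text \<open>Overwriting one coordinate of all cells by all values meets every cell \<open>N\<close> times. This isolates
  a single coordinate in a sum over cells without splitting the index set of the others.\<close>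
lemma sum_cells_resample:
  fixes \<phi> :: "('d::finite \<Rightarrow> nat) \<Rightarrow> real"
  shows "(\<Sum>c\<in>cells N. \<Sum>s<N. \<phi> (c(i := s))) = real N * (\<Sum>c\<in>cells N. \<phi> c)"
proof -
  have "(\<Sum>c\<in>cells N. \<Sum>s<N. \<phi> (c(i := s))) = (\<Sum>(c, s)\<in>cells N \<times> {..<N}. \<phi> (c(i := s)))"
    by (simp add: sum.cartesian_product)
  also have "\<dots> = (\<Sum>(c, s)\<in>cells N \<times> {..<N}. \<phi> c)"
    by (rule sum.reindex_bij_witness[where i = "\<lambda>(c, s). (c(i := s), c i)"
          and j = "\<lambda>(c, s). (c(i := s), c i)"]) (auto simp: cells_def)
  also have "\<dots> = real N * (\<Sum>c\<in>cells N. \<phi> c)"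
    by (simp add: sum.cartesian_product[symmetric] sum_distrib_left)
  finally show ?thesis .
qed

text \<open>The one-dimensional case. By Chebyshev's sum inequality the diagonal terms carry at least the
  average share \<open>1 / N\<close> of the double sum.\<close>
lemma sum_distinct_pairs_le:
  fixes h k :: "nat \<Rightarrow> real"
  assumes "(\<forall>s t. s \<le> t \<and> t < N \<longrightarrow> h s \<le> h t \<and> k s \<le> k t) \<or>
    (\<forall>s t. s \<le> t \<and> t < N \<longrightarrow> h t \<le> h s \<and> k t \<le> k s)"
  shows "real N * (\<Sum>s<N. \<Sum>t<N. if s \<noteq> t then h s * k t else 0)
    \<le> (real N - 1) * (\<Sum>s<N. \<Sum>t<N. h s * k t)"
proof -
  have diag: "(\<Sum>s<N. h s) * (\<Sum>s<N. k s) \<le> real N * (\<Sum>s<N. h s * k s)"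
    using assms
  proof
    assume "\<forall>s t. s \<le> t \<and> t < N \<longrightarrow> h s \<le> h t \<and> k s \<le> k t"
    then show ?thesis
      using Chebyshev_sum_upper[of N h "\<lambda>s. - k s"]
      by (simp add: lessThan_atLeast0 sum_negf)
  next
    assume "\<forall>s t. s \<le> t \<and> t < N \<longrightarrow> h t \<le> h s \<and> k t \<le> k s"
    then show ?thesis
      using Chebyshev_sum_upper[of N "\<lambda>s. - h s" k]
      by (simp add: lessThan_atLeast0 sum_negf)
  qed
  have "(\<Sum>s<N. \<Sum>t<N. if s \<noteq> t then h s * k t else 0)
      = (\<Sum>s<N. \<Sum>t<N. h s * k t - (if s = t then h s * k t else 0))"
    by (intro sum.cong refl) auto
  also have "\<dots> = (\<Sum>s<N. \<Sum>t<N. h s * k t) - (\<Sum>s<N. h s * k s)"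
    by (simp add: sum_subtractf sum.delta')
  finally have "(\<Sum>s<N. \<Sum>t<N. if s \<noteq> t then h s * k t else 0)
      = (\<Sum>s<N. \<Sum>t<N. h s * k t) - (\<Sum>s<N. h s * k s)" .
  then show ?thesis
    using diag unfolding sum_product[symmetric]
    by (simp only: left_diff_distrib right_diff_distrib)
qed

text \<open>The direction may depend on the coordinate but not on the cell: the inequality compares two
  lines in the same coordinate direction, along which the function has to vary in the same sense.\<close>
definition cellwise_monotone :: "nat \<Rightarrow> (('d::finite \<Rightarrow> nat) \<Rightarrow> real) \<Rightarrow> bool" where
  "cellwise_monotone N F \<longleftrightarrow>
     (\<forall>i. (\<forall>c\<in>cells N. \<forall>s t. s \<le> t \<and> t < N \<longrightarrow> F (c(i := s)) \<le> F (c(i := t)))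
        \<or> (\<forall>c\<in>cells N. \<forall>s t. s \<le> t \<and> t < N \<longrightarrow> F (c(i := t)) \<le> F (c(i := s))))"

text \<open>The restriction \<open>a i \<noteq> b i\<close> is imposed on one coordinate \<open>i\<close> at a time. With the other
  coordinates of both cells frozen, each new restriction is an instance of the one-dimensional
  case, because the restrictions that are already in force do not involve coordinate \<open>i\<close>.\<close>
lemma sum_separated_on_le:
  fixes F :: "('d::finite \<Rightarrow> nat) \<Rightarrow> real"
  assumes N: "N \<ge> 1" and F: "cellwise_monotone N F" and "finite A"
  shows "real N ^ card A *
      (\<Sum>a\<in>cells N. \<Sum>b\<in>cells N. if \<forall>i\<in>A. a i \<noteq> b i then F a * F b else 0)
    \<le> (real N - 1) ^ card A * (\<Sum>c\<in>cells N. F c)\<^sup>2"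
  using \<open>finite A\<close>
proof induction
  case empty
  then show ?case by (simp add: power2_eq_square sum_product)
next
  case (insert i A)
  define T :: "'d set \<Rightarrow> real"
    where "T B = (\<Sum>a\<in>cells N. \<Sum>b\<in>cells N. if \<forall>i\<in>B. a i \<noteq> b i then F a * F b else 0)" for B
  have resample: "(real N)\<^sup>2 * T B = (\<Sum>a\<in>cells N. \<Sum>b\<in>cells N. \<Sum>s<N. \<Sum>t<N.
      if \<forall>l\<in>B. (a(i := s)) l \<noteq> (b(i := t)) l then F (a(i := s)) * F (b(i := t)) else 0)" for B
  proof -
    have "(real N)\<^sup>2 * T B = real N * (\<Sum>a\<in>cells N. real N *
        (\<Sum>b\<in>cells N. if \<forall>l\<in>B. a l \<noteq> b l then F a * F b else 0))"
      by (simp add: T_def power2_eq_square sum_distrib_left mult.assoc)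
    also have "\<dots> = (\<Sum>a\<in>cells N. \<Sum>s<N. \<Sum>b\<in>cells N. \<Sum>t<N.
        if \<forall>l\<in>B. (a(i := s)) l \<noteq> (b(i := t)) l then F (a(i := s)) * F (b(i := t)) else 0)"
      by (simp only: sum_cells_resample[symmetric, where i = i])
    also have "\<dots> = (\<Sum>a\<in>cells N. \<Sum>b\<in>cells N. \<Sum>s<N. \<Sum>t<N.
        if \<forall>l\<in>B. (a(i := s)) l \<noteq> (b(i := t)) l then F (a(i := s)) * F (b(i := t)) else 0)"
      by (intro sum.cong refl sum.swap)
    finally show ?thesis .
  qed
  have line: "real N * (\<Sum>s<N. \<Sum>t<N. if \<forall>l\<in>insert i A. (a(i := s)) l \<noteq> (b(i := t)) l
        then F (a(i := s)) * F (b(i := t)) else 0)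
      \<le> (real N - 1) * (\<Sum>s<N. \<Sum>t<N. if \<forall>l\<in>A. (a(i := s)) l \<noteq> (b(i := t)) l
        then F (a(i := s)) * F (b(i := t)) else 0)"
    if "a \<in> cells N" "b \<in> cells N" for a b
  proof (cases "\<forall>l\<in>A. a l \<noteq> b l")
    case True
    with insert.hyps have "(\<forall>l\<in>insert i A. (a(i := s)) l \<noteq> (b(i := t)) l) \<longleftrightarrow> s \<noteq> t"
      "\<forall>l\<in>A. (a(i := s)) l \<noteq> (b(i := t)) l" for s t
      by auto
    then show ?thesis
      using F that sum_distinct_pairs_le[of N "\<lambda>s. F (a(i := s))" "\<lambda>t. F (b(i := t))"]
      by (simp add: cellwise_monotone_def) blast
  next
    case False
    then obtain l where "l \<in> A" "a l = b l" by blast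
    with insert.hyps have "l \<in> A" "(a(i := s)) l = (b(i := t)) l" for s t
      by auto
    then have "\<not> (\<forall>l\<in>insert i A. (a(i := s)) l \<noteq> (b(i := t)) l)"
      "\<not> (\<forall>l\<in>A. (a(i := s)) l \<noteq> (b(i := t)) l)" for s t
      by blast+
    then show ?thesis by (simp only: if_False) simp
  qed
  have "(real N)\<^sup>2 * (real N * T (insert i A)) \<le> (real N)\<^sup>2 * ((real N - 1) * T A)"
    unfolding mult.left_commute[of "(real N)\<^sup>2"] resample
    unfolding sum_distrib_left[of "real N" _ "cells N"] sum_distrib_left[of "real N - 1" _ "cells N"]
    by (intro sum_mono line)
  then have step: "real N * T (insert i A) \<le> (real N - 1) * T A"
    using N by (simp add: mult_le_cancel_left)
  have "real N ^ card (insert i A) * T (insert i A) = real N ^ card A * (real N * T (insert i A))"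
    using insert.hyps by (simp add: mult_ac)
  also have "\<dots> \<le> real N ^ card A * ((real N - 1) * T A)"
    using step by (intro mult_left_mono) auto
  also have "\<dots> = (real N - 1) * (real N ^ card A * T A)"
    by (simp add: mult_ac)
  also have "\<dots> \<le> (real N - 1) * ((real N - 1) ^ card A * (\<Sum>c\<in>cells N. F c)\<^sup>2)"
    using N insert.IH by (intro mult_left_mono) (auto simp: T_def)
  also have "\<dots> = (real N - 1) ^ card (insert i A) * (\<Sum>c\<in>cells N. F c)\<^sup>2"
    using insert.hyps by (simp add: mult_ac)
  finally show ?case by (simp add: T_def)
qed

lemma sum_separated_cells_le:
  fixes F :: "('d::finite \<Rightarrow> nat) \<Rightarrow> real"
  assumes N: "N \<ge> 1" and F: "cellwise_monotone N F"
  shows "real N ^ CARD('d) * (\<Sum>(a, b)\<in>separated_cells N. F a * F b)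
    \<le> (real N - 1) ^ CARD('d) * (\<Sum>c\<in>cells N. F c)\<^sup>2"
proof -
  have "(\<Sum>(a, b)\<in>separated_cells N. F a * F b)
      = (\<Sum>a\<in>cells N. \<Sum>b | (a, b) \<in> separated_cells N. F a * F b)"
    by (subst separated_cells_Sigma, subst sum.Sigma) auto
  also have "\<dots> = (\<Sum>a\<in>cells N. \<Sum>b\<in>cells N. if \<forall>i\<in>UNIV. a i \<noteq> b i then F a * F b else 0)"
  proof (rule sum.cong[OF refl])
    fix a :: "'d \<Rightarrow> nat" assume "a \<in> cells N"
    then have "{b. (a, b) \<in> separated_cells N} = {b \<in> cells N. \<forall>i\<in>UNIV. a i \<noteq> b i}"
      by (auto simp: separated_cells_def)
    then show "(\<Sum>b | (a, b) \<in> separated_cells N. F a * F b)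
        = (\<Sum>b\<in>cells N. if \<forall>i\<in>UNIV. a i \<noteq> b i then F a * F b else 0)"
      by (simp add: sum.inter_filter)
  qed
  finally show ?thesis
    using sum_separated_on_le[OF N F, of UNIV] by simp
qed

section \<open>The cells of the unit cube\<close>

lemma borel_measurable_vecI:
  fixes f :: "'a \<Rightarrow> real ^ 'd"
  assumes "\<And>i. (\<lambda>x. f x $ i) \<in> borel_measurable M"
  shows "f \<in> borel_measurable M"
proof (rule borel_measurable_euclidean_space[THEN iffD2], rule ballI)
  fix b :: "real ^ 'd" assume "b \<in> Basis"
  then obtain i where "b = axis i 1" by (auto simp: Basis_vec_def)
  then show "(\<lambda>x. f x \<bullet> b) \<in> borel_measurable M"
    using assms[of i] by (simp add: inner_axis)
qed

lemma borel_measurable_vec_nth' [measurable (raw)]: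
  fixes f :: "'a \<Rightarrow> real ^ 'd"
  assumes "f \<in> borel_measurable M"
  shows "(\<lambda>x. f x $ i) \<in> borel_measurable M"
proof -
  have "(\<lambda>x. f x \<bullet> axis i 1) \<in> borel_measurable M"
    using assms by measurable
  then show ?thesis by (simp add: inner_axis)
qed

lemma sets_vec_box:
  fixes A :: "'d::finite \<Rightarrow> real set"
  assumes "\<And>i. A i \<in> sets borel"
  shows "{x :: real ^ 'd. \<forall>i. x $ i \<in> A i} \<in> sets borel"
proof -
  have [measurable]: "A i \<in> sets borel" for i by fact
  have "Measurable.pred borel (\<lambda>x :: real ^ 'd. \<forall>i. x $ i \<in> A i)"
    by measurable
  then show ?thesis by (simp add: pred_def)
qed

text \<open>Coordinates indexed by \<open>'d\<close> rather than by basis vectors turn volumes of boxes with arbitrary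
  Borel sides into products over \<open>'d\<close>.\<close>
lemma lborel_eq_distr_PiM:
  "(lborel :: (real ^ 'd::finite) measure) = distr (Pi\<^sub>M UNIV (\<lambda>_. lborel)) borel vec_lambda"
proof (rule lborel_eqI)
  interpret product_sigma_finite "\<lambda>_ :: 'd. lborel :: real measure" ..
  have [measurable]: "vec_lambda \<in> borel_measurable (Pi\<^sub>M (UNIV :: 'd set) (\<lambda>_. lborel :: real measure))"
    by (rule borel_measurable_vecI) simp
  fix l u :: "real ^ 'd" assume le': "\<And>b. b \<in> Basis \<Longrightarrow> l \<bullet> b \<le> u \<bullet> b"
  have le: "l $ i \<le> u $ i" for i
    using le'[of "axis i 1"] by (auto simp: Basis_vec_def inner_axis)
  have "emeasure (distr (Pi\<^sub>M UNIV (\<lambda>_. lborel)) borel vec_lambda) (box l u)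
      = emeasure (Pi\<^sub>M UNIV (\<lambda>_. lborel)) (Pi\<^sub>E UNIV (\<lambda>i. {l $ i<..<u $ i}))"
    by (subst emeasure_distr)
       (auto intro!: arg_cong2[where f = emeasure] simp: space_PiM PiE_iff mem_box_cart)
  also have "\<dots> = (\<Prod>i\<in>UNIV. ennreal (u $ i - l $ i))"
    by (subst emeasure_PiM) (auto simp: le)
  also have "\<dots> = (\<Prod>i\<in>UNIV. u $ i - l $ i)"
    by (rule prod_ennreal) (simp add: le)
  also have "(\<Prod>i\<in>UNIV. u $ i - l $ i) = (\<Prod>b\<in>Basis. (u - l) \<bullet> b)"
    by (subst prod.reindex_bij_betw[symmetric, where h = "\<lambda>i. axis i (1::real)" and S = UNIV])
       (auto simp: bij_betw_def inj_on_def axis_eq_axis Basis_vec_def inner_axis)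
  finally show "emeasure (distr (Pi\<^sub>M UNIV (\<lambda>_. lborel)) borel vec_lambda) (box l u)
      = (\<Prod>b\<in>Basis. (u - l) \<bullet> b)" .
qed simp

lemma emeasure_lborel_vec_box:
  fixes A :: "'d::finite \<Rightarrow> real set"
  assumes "\<And>i. A i \<in> sets borel"
  shows "emeasure lborel {x :: real ^ 'd. \<forall>i. x $ i \<in> A i} = (\<Prod>i\<in>UNIV. emeasure lborel (A i))"
proof -
  interpret product_sigma_finite "\<lambda>_ :: 'd. lborel :: real measure" ..
  have [measurable]: "vec_lambda \<in> borel_measurable (Pi\<^sub>M (UNIV :: 'd set) (\<lambda>_. lborel :: real measure))"
    by (rule borel_measurable_vecI) simp
  have "emeasure lborel {x :: real ^ 'd. \<forall>i. x $ i \<in> A i}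
      = emeasure (Pi\<^sub>M UNIV (\<lambda>_. lborel)) (Pi\<^sub>E UNIV A)"
    by (subst lborel_eq_distr_PiM, subst emeasure_distr)
       (auto intro!: arg_cong2[where f = emeasure] sets_vec_box assms simp: space_PiM PiE_iff)
  also have "\<dots> = (\<Prod>i\<in>UNIV. emeasure lborel (A i))"
    by (rule emeasure_PiM) (auto simp: assms)
  finally show ?thesis .
qed

definition cell :: "nat \<Rightarrow> ('d::finite \<Rightarrow> nat) \<Rightarrow> (real ^ 'd) set" where
  "cell N c = {x. \<forall>i. x $ i \<in> {real (c i) / real N..<real (c i + 1) / real N}}"

lemma sets_cell [measurable]: "cell N c \<in> sets borel"
  unfolding cell_def by (rule sets_vec_box) simp

lemma half_open_cube_eq_box: "half_open_cube r = {x. \<forall>i. x $ i \<in> {0..<r}}"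
  by (auto simp: half_open_cube_def)

lemma sets_half_open_cube [measurable]: "half_open_cube r \<in> sets borel"
  unfolding half_open_cube_eq_box by (rule sets_vec_box) simp

lemma emeasure_half_open_cube:
  "r \<ge> 0 \<Longrightarrow> emeasure lborel (half_open_cube r :: (real ^ 'd::finite) set) = ennreal (r ^ CARD('d))"
  unfolding half_open_cube_eq_box by (subst emeasure_lborel_vec_box) (simp_all add: ennreal_power)

lemma emeasure_cell:
  assumes "N \<ge> 1"
  shows "emeasure lborel (cell N c :: (real ^ 'd::finite) set) = ennreal (1 / real N ^ CARD('d))"
proof -
  have "real (c i) / real N \<le> real (c i + 1) / real N" for i
    by (simp add: divide_right_mono)
  moreover have "real (c i + 1) / real N - real (c i) / real N = 1 / real N" for i
    by (simp add: diff_divide_distrib[symmetric])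
  ultimately show ?thesis
    unfolding cell_def by (subst emeasure_lborel_vec_box) (simp_all add: ennreal_power power_one_over)
qed

lemma cell_unique:
  assumes "N \<ge> 1" "x \<in> cell N a" "x \<in> cell N b" shows "a = b"
proof
  fix i
  have *: "real (a i) \<le> real N * x $ i" "real N * x $ i < real (a i + 1)"
    "real (b i) \<le> real N * x $ i" "real N * x $ i < real (b i + 1)"
    using assms by (auto simp: cell_def field_simps)
  then have "real (a i) < real (b i + 1)" "real (b i) < real (a i + 1)" by linarith+
  then show "a i = b i" by linarith
qed

lemma half_open_cube_eq_UN_cell:
  assumes "N \<ge> 1"
  shows "half_open_cube 1 = (\<Union>c\<in>cells N. cell N c)"
proof (intro set_eqI iffI)
  fix x :: "real ^ 'd" assume x: "x \<in> half_open_cube 1"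
  define c where "c i = nat \<lfloor>real N * x $ i\<rfloor>" for i
  have pos: "0 \<le> real N * x $ i" "real N * x $ i < real N" for i
    using x assms by (auto simp: half_open_cube_def)
  have c: "real (c i) \<le> real N * x $ i" "real N * x $ i < real (c i + 1)" for i
    using pos[of i] unfolding c_def by linarith+
  have "x \<in> cell N c"
    using c assms by (auto simp: cell_def field_simps)
  moreover have "c i < N" for i
    using c(1)[of i] pos(2)[of i] by linarith
  ultimately show "x \<in> (\<Union>c\<in>cells N. cell N c)"
    by (auto simp: cells_def)
next
  fix x :: "real ^ 'd" assume "x \<in> (\<Union>c\<in>cells N. cell N c)"
  then obtain c where c: "\<And>i. c i < N" "x \<in> cell N c" by (auto simp: cells_def)
  show "x \<in> half_open_cube 1"
    unfolding half_open_cube_def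
  proof safe
    fix i
    have "real (c i) / real N \<le> x $ i" "x $ i < real (c i + 1) / real N"
      using c by (auto simp: cell_def)
    moreover have "real (c i + 1) / real N \<le> 1"
      using c(1)[of i] assms by (simp add: field_simps)
    moreover have "0 \<le> real (c i) / real N" by simp
    ultimately show "0 \<le> x $ i" "x $ i < 1" by linarith+
  qed
qed

lemma cell_eq_translate:
  assumes "N \<ge> 1"
  shows "(\<chi> i. real (c i) / real N) + x \<in> cell N c \<longleftrightarrow> x \<in> half_open_cube (1 / real N)"
  using assms by (auto simp: cell_def half_open_cube_def add_divide_distrib)

section \<open>Uniformly distributed pairs of separated points\<close>

lemma emeasure_lborel_Times:
  fixes A :: "'a::euclidean_space set" and B :: "'b::euclidean_space set"
  assumes "A \<in> sets borel" "B \<in> sets borel"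
  shows "emeasure lborel (A \<times> B) = emeasure lborel A * emeasure lborel B"
  using assms by (simp add: lborel_prod[symmetric] lborel.emeasure_pair_measure_Times)

lemma borel_Times [measurable]:
  fixes A :: "'a::euclidean_space set" and B :: "'b::euclidean_space set"
  assumes "A \<in> sets borel" "B \<in> sets borel"
  shows "A \<times> B \<in> sets borel"
  using assms by (metis borel_prod pair_measureI)

lemma
  fixes f :: "'a::euclidean_space \<Rightarrow> real" and h :: "'b::euclidean_space \<Rightarrow> real"
  assumes f: "integrable lborel f" and h: "integrable lborel h"
  shows integrable_lborel_tensor: "integrable lborel (\<lambda>z. f (fst z) * h (snd z))" (is ?int)
    and integral_lborel_tensor: "(LINT z|lborel. f (fst z) * h (snd z))
      = (LINT x|lborel. f x) * (LINT y|lborel. h y)" (is ?eq)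
proof -
  have [measurable]: "f \<in> borel_measurable borel" "h \<in> borel_measurable borel"
    using f h by (auto dest: borel_measurable_integrable)
  have int: "integrable (lborel \<Otimes>\<^sub>M lborel) (\<lambda>z. f (fst z) * h (snd z))"
  proof (rule lborel_pair.Fubini_integrable)
    show "integrable lborel (\<lambda>x. LINT y|lborel. norm (f (fst (x, y)) * h (snd (x, y))))"
      using f by (simp add: abs_mult)
  qed (use h in simp_all)
  then show ?int by (simp add: lborel_prod)
  show ?eq
    using lborel_pair.integral_fst'[OF int] by (simp add: lborel_prod)
qed

lemma
  fixes f :: "'a \<Rightarrow> real"
  assumes A: "A \<in> sets M" and v: "emeasure M A = ennreal v" "v > 0"
    and f: "f \<in> borel_measurable M"
  shows integrable_uniform_measure:
      "integrable (uniform_measure M A) f \<longleftrightarrow> integrable M (\<lambda>x. indicator A x * f x)" (is ?int)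
    and integral_uniform_measure:
      "integral\<^sup>L (uniform_measure M A) f = (LINT x|M. indicator A x * f x) / v" (is ?eq)
proof -
  have d: "uniform_measure M A = density M (\<lambda>x. ennreal (indicator A x / v))"
    unfolding uniform_measure_def v(1)
    by (intro density_cong) (use A v in \<open>auto simp: indicator_def divide_ennreal ennreal_1[symmetric] simp del: ennreal_1\<close>)
  have "integrable (uniform_measure M A) f \<longleftrightarrow> integrable M (\<lambda>x. (indicator A x / v) *\<^sub>R f x)"
    unfolding d using A v f by (intro integrable_density) auto
  also have "(\<lambda>x. (indicator A x / v) *\<^sub>R f x) = (\<lambda>x. (1 / v) * (indicator A x * f x))"
    by auto
  also have "integrable M (\<lambda>x. (1 / v) * (indicator A x * f x)) \<longleftrightarrow> integrable M (\<lambda>x. indicator A x * f x)"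
    using v by (subst integrable_mult_left_iff) simp
  finally show ?int .
  have "integral\<^sup>L (uniform_measure M A) f = (LINT x|M. (indicator A x / v) *\<^sub>R f x)"
    unfolding d using A v f by (intro integral_density) auto
  also have "(\<lambda>x. (indicator A x / v) *\<^sub>R f x) = (\<lambda>x. (1 / v) * (indicator A x * f x))"
    by auto
  finally show ?eq by simp
qed

lemma uniform_lebesgue_integral:
  fixes A :: "'a::euclidean_space set" and \<phi> :: "'a \<Rightarrow> real"
  assumes X: "uniform_lebesgue M A X" and A: "A \<in> sets borel" "emeasure lborel A = ennreal v" "v > 0"
    and \<phi>: "\<phi> \<in> borel_measurable borel"
  shows "integrable M (\<lambda>\<omega>. \<phi> (X \<omega>)) \<longleftrightarrow> integrable lborel (\<lambda>x. indicator A x * \<phi> x)"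
    and "(LINT \<omega>|M. \<phi> (X \<omega>)) = (LINT x|lborel. indicator A x * \<phi> x) / v"
proof -
  have X': "X \<in> borel_measurable M" "distr M borel X = uniform_measure lborel A"
    using X by (auto simp: uniform_lebesgue_def)
  show "integrable M (\<lambda>\<omega>. \<phi> (X \<omega>)) \<longleftrightarrow> integrable lborel (\<lambda>x. indicator A x * \<phi> x)"
    using integrable_distr_eq[OF X'(1) \<phi>] integrable_uniform_measure[of A lborel v \<phi>] A \<phi>
    by (simp add: X'(2))
  show "(LINT \<omega>|M. \<phi> (X \<omega>)) = (LINT x|lborel. indicator A x * \<phi> x) / v"
    using integral_distr[OF X'(1) \<phi>] integral_uniform_measure[of A lborel v \<phi>] A \<phi>
    by (simp add: X'(2))
qed

text \<open>The support of the law of two different nodes: in every coordinate the two points lie in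
  different strips of width \<open>1 / N\<close>.\<close>
definition separated_pairs :: "nat \<Rightarrow> ((real ^ 'd::finite) \<times> (real ^ 'd)) set" where
  "separated_pairs N = (\<Union>(a, b)\<in>separated_cells N. cell N a \<times> cell N b)"

lemma sets_separated_pairs [measurable]: "separated_pairs N \<in> sets borel"
  unfolding separated_pairs_def
  by (intro sets.finite_UN finite_separated_cells) (auto intro: borel_Times sets_cell)

lemma disjoint_cell_products:
  fixes I :: "(('d::finite \<Rightarrow> nat) \<times> ('d \<Rightarrow> nat)) set"
  assumes "N \<ge> 1"
  shows "disjoint_family_on (\<lambda>(a, b). cell N a \<times> cell N b) I"
  unfolding disjoint_family_on_def
proof (intro ballI impI)
  fix ab cd :: "('d \<Rightarrow> nat) \<times> ('d \<Rightarrow> nat)" assume "ab \<noteq> cd"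
  then show "(case ab of (a, b) \<Rightarrow> cell N a \<times> cell N b) \<inter> (case cd of (a, b) \<Rightarrow> cell N a \<times> cell N b) = {}"
    by (cases ab; cases cd) (auto dest: cell_unique[OF assms])
qed

lemma indicator_separated_pairs:
  assumes "N \<ge> 1"
  shows "(indicator (separated_pairs N) (x, y) :: real)
    = (\<Sum>(a, b)\<in>separated_cells N. indicator (cell N a) x * indicator (cell N b) y)"
proof -
  have "(indicator (separated_pairs N) (x, y) :: real)
      = (\<Sum>ab\<in>separated_cells N. indicator (case ab of (a, b) \<Rightarrow> cell N a \<times> cell N b) (x, y))"
    unfolding separated_pairs_def
    by (rule indicator_UN_disjoint[OF _ disjoint_cell_products[OF assms]]) simp
  then show ?thesis
    by (simp add: indicator_times split_beta)
qed

lemma emeasure_separated_pairs_Times: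
  fixes P Q :: "(real ^ 'd::finite) set"
  assumes N: "N \<ge> 1" and PQ: "P \<in> sets borel" "Q \<in> sets borel"
  shows "emeasure lborel (separated_pairs N \<inter> P \<times> Q)
    = (\<Sum>(a, b)\<in>separated_cells N. emeasure lborel (cell N a \<inter> P) * emeasure lborel (cell N b \<inter> Q))"
proof -
  have "separated_pairs N \<inter> P \<times> Q
      = (\<Union>ab\<in>separated_cells N. (\<lambda>(a, b). (cell N a \<inter> P) \<times> (cell N b \<inter> Q)) ab)"
    by (auto simp: separated_pairs_def)
  also have "emeasure lborel \<dots>
      = (\<Sum>ab\<in>separated_cells N. emeasure lborel ((\<lambda>(a, b). (cell N a \<inter> P) \<times> (cell N b \<inter> Q)) ab))"
  proof (rule sum_emeasure[symmetric])
    show "disjoint_family_on (\<lambda>(a, b). (cell N a \<inter> P) \<times> (cell N b \<inter> Q)) (separated_cells N)"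
      by (rule disjoint_family_on_bisimulation[OF disjoint_cell_products[OF N]]) auto
  qed (use PQ in \<open>auto intro!: borel_Times\<close>)
  also have "\<dots> = (\<Sum>(a, b)\<in>separated_cells N. emeasure lborel (cell N a \<inter> P) * emeasure lborel (cell N b \<inter> Q))"
    using PQ by (intro sum.cong refl) (auto simp: emeasure_lborel_Times)
  finally show ?thesis .
qed

lemma emeasure_separated_pairs:
  assumes N: "N \<ge> 1"
  shows "emeasure lborel (separated_pairs N :: ((real ^ 'd::finite) \<times> _) set)
    = ennreal (((real N - 1) / real N) ^ CARD('d))"
proof -
  have "emeasure lborel (separated_pairs N :: ((real ^ 'd) \<times> _) set)
      = (\<Sum>(a, b)\<in>(separated_cells N :: (('d \<Rightarrow> nat) \<times> _) set).
          ennreal (1 / real N ^ CARD('d)) * ennreal (1 / real N ^ CARD('d)))"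
    using emeasure_separated_pairs_Times[OF N, of UNIV UNIV] by (simp add: emeasure_cell[OF N])
  also have "\<dots> = ennreal (real (card (separated_cells N :: (('d \<Rightarrow> nat) \<times> _) set)) * (1 / real N ^ CARD('d) * (1 / real N ^ CARD('d))))"
    by (simp add: ennreal_mult[symmetric] ennreal_of_nat_eq_real_of_nat)
  also have "real (card (separated_cells N :: (('d \<Rightarrow> nat) \<times> _) set)) * (1 / real N ^ CARD('d) * (1 / real N ^ CARD('d)))
      = ((real N - 1) / real N) ^ CARD('d)"
    using N by (simp add: card_separated_cells power_mult_distrib power_divide of_nat_diff)
  finally show ?thesis .
qed

lemma integral_cube_eq_sum_cells:
  fixes g :: "real ^ 'd::finite \<Rightarrow> real"
  assumes N: "N \<ge> 1" and g[measurable]: "g \<in> borel_measurable borel"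
    and int: "integrable lborel (\<lambda>x. indicator (half_open_cube 1) x * g x)"
  shows "(\<Sum>c\<in>cells N. LINT x|lborel. indicator (cell N c) x * g x)
    = (LINT x|lborel. indicator (half_open_cube 1) x * g x)"
    and "c \<in> cells N \<Longrightarrow> integrable lborel (\<lambda>x. indicator (cell N c) x * g x)"
proof -
  show int_cell: "integrable lborel (\<lambda>x. indicator (cell N c) x * g x)" if "c \<in> cells N" for c
  proof -
    have "cell N c \<subseteq> half_open_cube 1"
      using that by (auto simp: half_open_cube_eq_UN_cell[OF N])
    then have "(\<lambda>x. indicator (cell N c) x * g x)
        = (\<lambda>x. indicator (cell N c) x * (indicator (half_open_cube 1) x * g x))"
      by (auto simp: indicator_def fun_eq_iff)
    then show ?thesis
      using integrable_real_mult_indicator[OF _ int, of "cell N c"] by (simp add: mult.commute)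
  qed
  have ind: "(indicator (half_open_cube 1) x :: real) = (\<Sum>c\<in>cells N. indicator (cell N c) x)" for x :: "real ^ 'd"
    unfolding half_open_cube_eq_UN_cell[OF N]
    by (rule indicator_UN_disjoint) (auto simp: disjoint_family_on_def dest: cell_unique[OF N])
  show "(\<Sum>c\<in>cells N. LINT x|lborel. indicator (cell N c) x * g x)
    = (LINT x|lborel. indicator (half_open_cube 1) x * g x)"
    unfolding ind sum_distrib_right
    by (rule Bochner_Integration.integral_sum[symmetric]) (rule int_cell)
qed

text \<open>The indicator of the separated pairs is a sum of indicators of products of cells, over which the
  integral of \<open>g x * g y\<close> factorises.\<close>
lemma expectation_separated_pair:
  fixes p q :: "'w \<Rightarrow> real ^ 'd::finite" and g :: "real ^ 'd \<Rightarrow> real"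
  assumes N: "N \<ge> 2" and pq: "uniform_lebesgue M (separated_pairs N) (\<lambda>\<omega>. (p \<omega>, q \<omega>))"
    and g[measurable]: "g \<in> borel_measurable borel"
    and int: "integrable lborel (\<lambda>x. indicator (half_open_cube 1) x * g x)"
  shows "((real N - 1) / real N) ^ CARD('d) * (LINT \<omega>|M. g (p \<omega>) * g (q \<omega>))
    = (\<Sum>(a, b)\<in>separated_cells N. (LINT x|lborel. indicator (cell N a) x * g x)
        * (LINT x|lborel. indicator (cell N b) x * g x))"
proof -
  have N1: "N \<ge> 1" using N by simp
  note int_cell = integral_cube_eq_sum_cells(2)[OF N1 g int]
  have "(\<lambda>z. g (fst z) * g (snd z)) \<in> borel_measurable borel"
    unfolding borel_prod[symmetric] by measurable
  note law = uniform_lebesgue_integral(2)[OF pq _ emeasure_separated_pairs[OF N1] _ this]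
  have v: "0 < ((real N - 1) / real N) ^ CARD('d)" using N by simp
  have "((real N - 1) / real N) ^ CARD('d) * (LINT \<omega>|M. g (p \<omega>) * g (q \<omega>))
      = (LINT z|lborel. indicator (separated_pairs N) z * (g (fst z) * g (snd z)))"
    using law v N
    by (simp add: field_simps)
  also have "\<dots> = (LINT z|lborel. (\<Sum>(a, b)\<in>separated_cells N.
      (indicator (cell N a) (fst z) * g (fst z)) * (indicator (cell N b) (snd z) * g (snd z))))"
  proof (rule Bochner_Integration.integral_cong[OF refl])
    fix z :: "(real ^ 'd) \<times> (real ^ 'd)"
    obtain x y where z: "z = (x, y)" by fastforce
    show "indicator (separated_pairs N) z * (g (fst z) * g (snd z))
        = (\<Sum>(a, b)\<in>separated_cells N.
            (indicator (cell N a) (fst z) * g (fst z)) * (indicator (cell N b) (snd z) * g (snd z)))"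
      unfolding z indicator_separated_pairs[OF N1] sum_distrib_right fst_conv snd_conv
      by (intro sum.cong refl) (simp add: split_beta mult_ac)
  qed
  also have "\<dots> = (\<Sum>ab\<in>separated_cells N. LINT z|lborel.
      (indicator (cell N (fst ab)) (fst z) * g (fst z)) * (indicator (cell N (snd ab)) (snd z) * g (snd z)))"
    unfolding split_beta
    by (rule Bochner_Integration.integral_sum)
       (intro integrable_lborel_tensor int_cell; auto simp: separated_cells_def)
  also have "\<dots> = (\<Sum>ab\<in>separated_cells N. (LINT x|lborel. indicator (cell N (fst ab)) x * g x)
        * (LINT x|lborel. indicator (cell N (snd ab)) x * g x))"
    by (intro sum.cong refl integral_lborel_tensor int_cell) (auto simp: separated_cells_def)
  finally show ?thesis by (simp add: split_beta)
qed

section \<open>Variances of quadratures with uniform nodes\<close>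

text \<open>A Borel function allows the use of the law of a node, which only knows Borel sets.\<close>
lemma square_integrable_borel_version:
  fixes f :: "real ^ 'd::finite \<Rightarrow> real"
  assumes f: "square_integrable_on (half_open_cube 1) f"
  obtains g where "g \<in> borel_measurable borel"
    "AE x in lborel. x \<in> half_open_cube 1 \<longrightarrow> f x = g x"
    "integrable lborel (\<lambda>x. indicator (half_open_cube 1) x * (g x)\<^sup>2)"
proof -
  have C: "half_open_cube 1 \<in> sets (lebesgue :: (real ^ 'd) measure)"
    by (metis sets_completionI_sets sets_half_open_cube sets_lborel)
  have "(\<lambda>x. if x \<in> half_open_cube 1 then f x else 0) \<in> borel_measurable lebesgue"
    using f C by (intro borel_measurable_if_I) (auto simp: square_integrable_on_def)
  from completion_ex_borel_measurable_real[OF this]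
  obtain g where g: "g \<in> borel_measurable borel"
    and ae: "AE x in lborel. (if x \<in> half_open_cube 1 then f x else 0) = g x"
    by auto
  note [measurable] = g
  have fg: "AE x in lborel. x \<in> half_open_cube 1 \<longrightarrow> f x = g x"
    using ae by eventually_elim (auto split: if_splits)
  have "integrable lebesgue (\<lambda>x. indicator (half_open_cube 1) x * (f x)\<^sup>2)"
    using f C by (simp add: square_integrable_on_def integrable_restrict_space)
  moreover have "(\<lambda>x. indicator (half_open_cube 1) x * (g x)\<^sup>2) \<in> borel_measurable lebesgue"
    by (rule measurable_completion) simp
  moreover have "AE x in lebesgue. indicator (half_open_cube 1) x * (f x)\<^sup>2
      = indicator (half_open_cube 1) x * (g x)\<^sup>2"
    using AE_completion[OF fg] by eventually_elim (auto simp: indicator_def)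
  ultimately have "integrable lebesgue (\<lambda>x. indicator (half_open_cube 1) x * (g x)\<^sup>2)"
    by (rule integrable_cong_AE_imp)
  then have "integrable lborel (\<lambda>x. indicator (half_open_cube 1) x * (g x)\<^sup>2)"
    by (simp add: integrable_completion)
  with g fg that show ?thesis by blast
qed

lemma integrable_cube_of_square_integrable:
  fixes g :: "real ^ 'd::finite \<Rightarrow> real"
  assumes g[measurable]: "g \<in> borel_measurable borel"
    and sq: "integrable lborel (\<lambda>x. indicator (half_open_cube 1) x * (g x)\<^sup>2)"
  shows "integrable lborel (\<lambda>x. indicator (half_open_cube 1) x * g x)"
proof (rule Bochner_Integration.integrable_bound)
  have "emeasure lborel (half_open_cube 1 :: (real ^ 'd) set) < \<infinity>"
    by (simp add: emeasure_half_open_cube)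
  then have "integrable lborel (indicator (half_open_cube 1) :: real ^ 'd \<Rightarrow> real)"
    by (simp add: integrable_indicator_iff)
  with sq show "integrable lborel (\<lambda>x. indicator (half_open_cube 1) x
      + indicator (half_open_cube 1) x * (g x)\<^sup>2)"
    by (rule Bochner_Integration.integrable_add[rotated])
  have "\<bar>y\<bar> \<le> 1 + y\<^sup>2" for y :: real
    using zero_le_power2[of "\<bar>y\<bar> - 1"] by (simp add: power2_eq_square algebra_simps) 
  then show "AE x in lborel. norm (indicator (half_open_cube 1) x * g x)
      \<le> norm (indicator (half_open_cube 1) x + indicator (half_open_cube 1) x * (g x)\<^sup>2 :: real)"
    by (auto simp: indicator_def)
qed simp

text \<open>Both integrals are moved to the cell at the origin by translation; there the translates of
  \<open>f\<close> can be compared point by point, and those of \<open>g\<close> almost everywhere.\<close>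
lemma cellwise_monotone_integrals:
  fixes f g :: "real ^ 'd::finite \<Rightarrow> real"
  assumes N: "N \<ge> 1" and mono: "monotone_in_each_coordinate_on (half_open_cube 1) f"
    and g[measurable]: "g \<in> borel_measurable borel"
    and fg: "AE x in lborel. x \<in> half_open_cube 1 \<longrightarrow> f x = g x"
    and int: "integrable lborel (\<lambda>x. indicator (half_open_cube 1) x * g x)"
  shows "cellwise_monotone N (\<lambda>c. LINT x|lborel. indicator (cell N c) x * g x)"
proof -
  define z :: "('d \<Rightarrow> nat) \<Rightarrow> real ^ 'd" where "z c = (\<chi> i. real (c i) / real N)" for c
  define Q :: "(real ^ 'd) set" where "Q = half_open_cube (1 / real N)"
  have [measurable]: "Q \<in> sets borel" unfolding Q_def by simp
  have ind: "indicator (cell N c) (z c + x) = (indicator Q x :: real)" for c x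
    using cell_eq_translate[OF N, of c x] by (simp add: indicator_def z_def Q_def)
  have translate: "(LINT x|lborel. indicator (cell N c) x * g x)
        = (LINT x|lborel. indicator Q x * g (z c + x))"
      "integrable lborel (\<lambda>x. indicator (cell N c) x * g x)
        \<longleftrightarrow> integrable lborel (\<lambda>x. indicator Q x * g (z c + x))" for c
    using integral_distr[of "(+) (z c)" lborel borel "\<lambda>x. indicator (cell N c) x * g x"]
      integrable_distr_eq[of "(+) (z c)" lborel borel "\<lambda>x. indicator (cell N c) x * g x"]
    by (simp_all add: lborel_distr_plus ind)
  have in_cube: "z c + x \<in> half_open_cube 1" if "c \<in> cells N" "x \<in> Q" for c x
    using that cell_eq_translate[OF N, of c x]
    by (auto simp: half_open_cube_eq_UN_cell[OF N] z_def Q_def)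
  have ae: "AE x in lborel. x \<in> Q \<longrightarrow> g (z c + x) = f (z c + x)" if "c \<in> cells N" for c
  proof -
    have "AE x in distr lborel borel ((+) (z c)). x \<in> half_open_cube 1 \<longrightarrow> f x = g x"
      by (subst lborel_distr_plus) (rule fg)
    then have "AE x in lborel. z c + x \<in> half_open_cube 1 \<longrightarrow> f (z c + x) = g (z c + x)"
      by (rule AE_distrD[rotated]) simp
    then show ?thesis
      by eventually_elim (use in_cube that in auto)
  qed
  have compare: "(LINT x|lborel. indicator (cell N c) x * g x) \<le> (LINT x|lborel. indicator (cell N c') x * g x)"
    if c: "c \<in> cells N" "c' \<in> cells N" and le: "\<And>x. x \<in> Q \<Longrightarrow> f (z c + x) \<le> f (z c' + x)" for c c'
    unfolding translate
  proof (rule integral_mono_AE)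
    show "integrable lborel (\<lambda>x. indicator Q x * g (z c + x))"
      "integrable lborel (\<lambda>x. indicator Q x * g (z c' + x))"
      using integral_cube_eq_sum_cells(2)[OF N g int] c by (simp_all add: translate[symmetric])
    show "AE x in lborel. indicator Q x * g (z c + x) \<le> indicator Q x * g (z c' + x)"
      using ae[OF c(1)] ae[OF c(2)] by eventually_elim (use le in \<open>auto simp: indicator_def\<close>)
  qed
  show ?thesis
    unfolding cellwise_monotone_def
  proof
    fix i
    have upd: "c(i := s) \<in> cells N" "c(i := t) \<in> cells N"
      "\<forall>k. k \<noteq> i \<longrightarrow> (z (c(i := s)) + x) $ k = (z (c(i := t)) + x) $ k"
      "(z (c(i := s)) + x) $ i \<le> (z (c(i := t)) + x) $ i"
      if "c \<in> cells N" "s \<le> t" "t < N" for c s t x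
      using that by (auto simp: cells_def z_def divide_right_mono)
    show "(\<forall>c\<in>cells N. \<forall>s t. s \<le> t \<and> t < N \<longrightarrow>
        (LINT x|lborel. indicator (cell N (c(i := s))) x * g x) \<le> (LINT x|lborel. indicator (cell N (c(i := t))) x * g x)) \<or>
      (\<forall>c\<in>cells N. \<forall>s t. s \<le> t \<and> t < N \<longrightarrow>
        (LINT x|lborel. indicator (cell N (c(i := t))) x * g x) \<le> (LINT x|lborel. indicator (cell N (c(i := s))) x * g x))"
      using mono[unfolded monotone_in_each_coordinate_on_def, rule_format, of i]
    proof
      assume up: "\<forall>x\<in>half_open_cube 1. \<forall>y\<in>half_open_cube 1.
        (\<forall>k. k \<noteq> i \<longrightarrow> x $ k = y $ k) \<and> x $ i \<le> y $ i \<longrightarrow> f x \<le> f y"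
      have "f (z (c(i := s)) + x) \<le> f (z (c(i := t)) + x)"
        if "c \<in> cells N" "s \<le> t" "t < N" "x \<in> Q" for c s t x
        using up[rule_format, OF in_cube in_cube] upd[OF that(1-3)] that(4) by blast
      then show ?thesis
        by (intro disjI1 ballI allI impI, elim conjE) (rule compare; simp only: upd)
    next
      assume down: "\<forall>x\<in>half_open_cube 1. \<forall>y\<in>half_open_cube 1.
        (\<forall>k. k \<noteq> i \<longrightarrow> x $ k = y $ k) \<and> x $ i \<le> y $ i \<longrightarrow> f y \<le> f x"
      have "f (z (c(i := t)) + x) \<le> f (z (c(i := s)) + x)"
        if "c \<in> cells N" "s \<le> t" "t < N" "x \<in> Q" for c s t x
        using down[rule_format, OF in_cube in_cube] upd[OF that(1-3)] that(4) by blast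
      then show ?thesis
        by (intro disjI2 ballI allI impI, elim conjE) (rule compare; simp only: upd)
    qed
  qed
qed

text \<open>The volume of the separated pairs and the constant in the sum inequality for cells are the same
  number \<open>(1 - 1 / N) ^ d\<close>, so the two cancel.\<close>
lemma separated_pair_negatively_correlated:
  fixes f g :: "real ^ 'd::finite \<Rightarrow> real"
  assumes N: "N \<ge> 2" and mono: "monotone_in_each_coordinate_on (half_open_cube 1) f"
    and g: "g \<in> borel_measurable borel"
    and fg: "AE x in lborel. x \<in> half_open_cube 1 \<longrightarrow> f x = g x"
    and int: "integrable lborel (\<lambda>x. indicator (half_open_cube 1) x * g x)"
    and pq: "uniform_lebesgue M (separated_pairs N) (\<lambda>\<omega>. (p \<omega>, q \<omega>))"
  shows "(LINT \<omega>|M. g (p \<omega>) * g (q \<omega>)) \<le> (LINT x|lborel. indicator (half_open_cube 1) x * g x)\<^sup>2"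
proof -
  have N1: "N \<ge> 1" using N by simp
  let ?G = "\<lambda>c. LINT x|lborel. indicator (cell N c) x * g x"
  let ?r = "((real N - 1) / real N) ^ CARD('d)"
  have r: "?r > 0" using N by simp
  have "real N ^ CARD('d) * (\<Sum>(a, b)\<in>separated_cells N. ?G a * ?G b)
      \<le> (real N - 1) ^ CARD('d) * (\<Sum>c\<in>cells N. ?G c)\<^sup>2"
    by (rule sum_separated_cells_le[OF N1 cellwise_monotone_integrals[OF N1 mono g fg int]])
  then have "(\<Sum>(a, b)\<in>separated_cells N. ?G a * ?G b) \<le> ?r * (\<Sum>c\<in>cells N. ?G c)\<^sup>2"
    using N by (simp add: power_divide field_simps)
  then have "?r * (LINT \<omega>|M. g (p \<omega>) * g (q \<omega>)) \<le> ?r * (\<Sum>c\<in>cells N. ?G c)\<^sup>2"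
    unfolding expectation_separated_pair[OF N pq g int] .
  then show ?thesis
    using r by (simp only: mult_le_cancel_left_pos integral_cube_eq_sum_cells(1)[OF N1 g int])
qed

text \<open>The two functions may differ on a set that is not measurable; the completion contains it because it
  lies in a null set.\<close>
lemma borel_measurable_completion_cong_AE:
  fixes X Y :: "'a \<Rightarrow> real"
  assumes Y: "Y \<in> borel_measurable M" and ae: "AE \<omega> in M. X \<omega> = Y \<omega>"
  shows "X \<in> borel_measurable (completion M)"
proof (rule measurableI)
  fix A :: "real set" assume A: "A \<in> sets borel"
  have "AE \<omega> in M. \<not> (X \<omega> \<noteq> Y \<omega> \<and> X \<omega> \<in> A)" "AE \<omega> in M. \<not> (X \<omega> \<noteq> Y \<omega>)"
    using ae by auto
  from this[THEN sets_completion_AE]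
  have "{\<omega> \<in> space M. X \<omega> \<noteq> Y \<omega> \<and> X \<omega> \<in> A} \<in> sets (completion M)"
    "{\<omega> \<in> space M. X \<omega> \<noteq> Y \<omega>} \<in> sets (completion M)"
    by (simp_all add: pred_def)
  moreover have "Y -` A \<inter> space M \<in> sets (completion M)"
    using Y A by (intro sets_completionI_sets measurable_sets)
  ultimately have "(Y -` A \<inter> space M - {\<omega> \<in> space M. X \<omega> \<noteq> Y \<omega>})
      \<union> {\<omega> \<in> space M. X \<omega> \<noteq> Y \<omega> \<and> X \<omega> \<in> A} \<in> sets (completion M)"
    by auto
  also have "(Y -` A \<inter> space M - {\<omega> \<in> space M. X \<omega> \<noteq> Y \<omega>})
      \<union> {\<omega> \<in> space M. X \<omega> \<noteq> Y \<omega> \<and> X \<omega> \<in> A} = X -` A \<inter> space (completion M)"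
    by auto
  finally show "X -` A \<inter> space (completion M) \<in> sets (completion M)" .
qed simp

lemma completed_variance_cong_AE:
  assumes Y[measurable]: "Y \<in> borel_measurable M" and ae: "AE \<omega> in M. X \<omega> = Y \<omega>"
  shows "completed_variance M X = (LINT \<omega>|M. (Y \<omega> - (LINT \<omega>|M. Y \<omega>))\<^sup>2)"
proof -
  note [measurable] = borel_measurable_completion_cong_AE[OF assms] measurable_completion[OF Y]
  note ae' = AE_completion[OF ae]
  have "integral\<^sup>L (completion M) X = integral\<^sup>L (completion M) Y"
    by (rule integral_cong_AE) (use ae' in auto)
  also have "\<dots> = integral\<^sup>L M Y" by (rule integral_completion) simp
  finally have m: "integral\<^sup>L (completion M) X = integral\<^sup>L M Y" .
  have "completed_variance M X = (LINT \<omega>|completion M. (X \<omega> - integral\<^sup>L M Y)\<^sup>2)"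
    by (simp add: completed_variance_def m)
  also have "\<dots> = (LINT \<omega>|completion M. (Y \<omega> - integral\<^sup>L M Y)\<^sup>2)"
    by (rule integral_cong_AE) (use ae' in auto)
  also have "\<dots> = (LINT \<omega>|M. (Y \<omega> - integral\<^sup>L M Y)\<^sup>2)"
    by (rule integral_completion) simp
  finally show ?thesis .
qed

lemma uniform_cube_integral:
  fixes \<phi> :: "real ^ 'd::finite \<Rightarrow> real"
  assumes "uniform_lebesgue M (half_open_cube 1) X" "\<phi> \<in> borel_measurable borel"
  shows "integrable M (\<lambda>\<omega>. \<phi> (X \<omega>)) \<longleftrightarrow> integrable lborel (\<lambda>x. indicator (half_open_cube 1) x * \<phi> x)"
    and "(LINT \<omega>|M. \<phi> (X \<omega>)) = (LINT x|lborel. indicator (half_open_cube 1) x * \<phi> x)"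
  using uniform_lebesgue_integral[OF assms(1) _ _ zero_less_one assms(2)]
  by (simp_all add: emeasure_half_open_cube)

text \<open>The function \<open>f\<close> can be replaced by \<open>g\<close> because a uniformly distributed node almost surely avoids
  the null set where they differ.\<close>
lemma completed_variance_quadrature:
  fixes f g :: "real ^ 'd::finite \<Rightarrow> real"
  assumes "prob_space M" and N: "N \<ge> 1"
    and g[measurable]: "g \<in> borel_measurable borel"
    and fg: "AE x in lborel. x \<in> half_open_cube 1 \<longrightarrow> f x = g x"
    and sq: "integrable lborel (\<lambda>x. indicator (half_open_cube 1) x * (g x)\<^sup>2)"
    and p: "\<And>j. j \<in> {1..N} \<Longrightarrow> uniform_lebesgue M (half_open_cube 1) (p j)"
  shows "completed_variance M (quadrature N p f)
    = (\<Sum>j=1..N. \<Sum>k=1..N. LINT \<omega>|M. g (p j \<omega>) * g (p k \<omega>)) / (real N)\<^sup>2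
      - (LINT x|lborel. indicator (half_open_cube 1) x * g x)\<^sup>2"
proof -
  interpret prob_space M by fact
  let ?m = "LINT x|lborel. indicator (half_open_cube 1) x * g x"
  let ?Q = "quadrature N p g"
  have p_meas [measurable]: "p j \<in> borel_measurable M" if "j \<in> {1..N}" for j
    using p[OF that] by (simp add: uniform_lebesgue_def)
  have ae: "AE \<omega> in M. f (p j \<omega>) = g (p j \<omega>)" if j: "j \<in> {1..N}" for j
  proof -
    have "AE x in uniform_measure lborel (half_open_cube 1). f x = g x"
      by (rule AE_uniform_measureI) (use fg in simp_all)
    moreover have "distr M borel (p j) = uniform_measure lborel (half_open_cube 1)"
      using p[OF j] by (simp add: uniform_lebesgue_def)
    ultimately have "AE x in distr M borel (p j). f x = g x" by (simp only:)
    then show ?thesis by (rule AE_distrD[OF p_meas[OF j]])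
  qed
  have "AE \<omega> in M. \<forall>j\<in>{1..N}. f (p j \<omega>) = g (p j \<omega>)"
    by (rule AE_finite_allI) (use ae in auto)
  then have aeQ: "AE \<omega> in M. quadrature N p f \<omega> = ?Q \<omega>"
    by eventually_elim (simp add: quadrature_def)
  have Q_meas: "?Q \<in> borel_measurable M"
    unfolding quadrature_def by measurable
  have sq_int: "integrable M (\<lambda>\<omega>. (g (p j \<omega>))\<^sup>2)" if "j \<in> {1..N}" for j
    using uniform_cube_integral(1)[OF p[OF that], of "\<lambda>x. (g x)\<^sup>2"] sq by simp
  have int: "integrable M (\<lambda>\<omega>. g (p j \<omega>))" "(LINT \<omega>|M. g (p j \<omega>)) = ?m" if "j \<in> {1..N}" for j
    using uniform_cube_integral[OF p[OF that] g] integrable_cube_of_square_integrable[OF g sq] by simp_all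
  have prod_int: "integrable M (\<lambda>\<omega>. g (p j \<omega>) * g (p k \<omega>))" if "j \<in> {1..N}" "k \<in> {1..N}" for j k
  proof (rule Bochner_Integration.integrable_bound)
    show "integrable M (\<lambda>\<omega>. (g (p j \<omega>))\<^sup>2 + (g (p k \<omega>))\<^sup>2)"
      using that by (intro Bochner_Integration.integrable_add sq_int)
    have "\<bar>x * y\<bar> \<le> x\<^sup>2 + y\<^sup>2" for x y :: real
    proof -
      have "2 * (\<bar>x\<bar> * \<bar>y\<bar>) \<le> x\<^sup>2 + y\<^sup>2"
        using sum_squares_bound[of "\<bar>x\<bar>" "\<bar>y\<bar>"] by (simp add: mult.assoc)
      moreover have "0 \<le> \<bar>x\<bar> * \<bar>y\<bar>" by simp
      ultimately show ?thesis unfolding abs_mult by linarith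
    qed
    then show "AE \<omega> in M. norm (g (p j \<omega>) * g (p k \<omega>)) \<le> norm ((g (p j \<omega>))\<^sup>2 + (g (p k \<omega>))\<^sup>2)"
      by simp
  qed (use that in measurable)
  have Qsq: "(?Q \<omega>)\<^sup>2 = (\<Sum>j=1..N. \<Sum>k=1..N. g (p j \<omega>) * g (p k \<omega>)) / (real N)\<^sup>2" for \<omega>
    by (simp add: quadrature_def power2_eq_square sum_product)
  have "integrable M ?Q"
    unfolding quadrature_def using int(1) by (intro integrable_mult_right Bochner_Integration.integrable_sum) auto
  moreover have "integrable M (\<lambda>\<omega>. (?Q \<omega>)\<^sup>2)"
    unfolding Qsq using prod_int
    by (intro integrable_divide Bochner_Integration.integrable_sum) auto
  ultimately have "variance ?Q = expectation (\<lambda>\<omega>. (?Q \<omega>)\<^sup>2) - (expectation ?Q)\<^sup>2"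
    by (rule variance_eq)
  moreover have "expectation ?Q = ?m"
  proof -
    have "expectation ?Q = (1 / real N) * (\<Sum>j=1..N. LINT \<omega>|M. g (p j \<omega>))"
      unfolding quadrature_def using int(1)
      by (subst integral_mult_right_zero, subst Bochner_Integration.integral_sum) auto
    also have "\<dots> = (1 / real N) * (\<Sum>j=1..N. ?m)"
      using int(2) by (intro arg_cong[where f = "(*) (1 / real N)"] sum.cong) auto
    finally show ?thesis using N by simp
  qed
  moreover have "expectation (\<lambda>\<omega>. (?Q \<omega>)\<^sup>2)
      = (\<Sum>j=1..N. \<Sum>k=1..N. LINT \<omega>|M. g (p j \<omega>) * g (p k \<omega>)) / (real N)\<^sup>2"
  proof -
    have "expectation (\<lambda>\<omega>. \<Sum>j=1..N. \<Sum>k=1..N. g (p j \<omega>) * g (p k \<omega>))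
        = (\<Sum>j=1..N. LINT \<omega>|M. (\<Sum>k=1..N. g (p j \<omega>) * g (p k \<omega>)))"
      using prod_int by (intro Bochner_Integration.integral_sum Bochner_Integration.integrable_sum) auto
    also have "\<dots> = (\<Sum>j=1..N. \<Sum>k=1..N. LINT \<omega>|M. g (p j \<omega>) * g (p k \<omega>))"
      using prod_int by (intro sum.cong[OF refl] Bochner_Integration.integral_sum) auto
    finally show ?thesis unfolding Qsq by simp
  qed
  ultimately show ?thesis
    using completed_variance_cong_AE[OF Q_meas aeQ] by simp
qed

lemma monte_carlo_expectation:
  fixes g :: "real ^ 'd::finite \<Rightarrow> real"
  assumes "prob_space M" and u: "monte_carlo_sample M N u" and jk: "j \<in> {1..N}" "k \<in> {1..N}" "j \<noteq> k"
    and g[measurable]: "g \<in> borel_measurable borel"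
    and int: "integrable lborel (\<lambda>x. indicator (half_open_cube 1) x * g x)"
  shows "(LINT \<omega>|M. g (u j \<omega>) * g (u k \<omega>)) = (LINT x|lborel. indicator (half_open_cube 1) x * g x)\<^sup>2"
proof -
  interpret prob_space M by fact
  have "indep_vars (\<lambda>_. borel) u {1..N}"
    using u by (simp add: monte_carlo_sample_def)
  then have "indep_vars (\<lambda>_. borel) u {j, k}"
    by (rule indep_vars_subset) (use jk in auto)
  then have "indep_vars (\<lambda>_. borel) (\<lambda>i \<omega>. g (u i \<omega>)) {j, k}"
    by (rule indep_vars_compose2) simp
  moreover have unif: "uniform_lebesgue M (half_open_cube 1) (u i)" if "i \<in> {j, k}" for i
    using u jk that by (auto simp: monte_carlo_sample_def)
  ultimately have "(LINT \<omega>|M. (\<Prod>i\<in>{j, k}. g (u i \<omega>))) = (\<Prod>i\<in>{j, k}. LINT \<omega>|M. g (u i \<omega>))"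
    using uniform_cube_integral(1)[OF unif g] int
    by (intro indep_vars_lebesgue_integral) auto
  then show ?thesis
    using jk uniform_cube_integral(2)[OF unif g] by (simp add: power2_eq_square)
qed

text \<open>The randomness of the point set enters only through the laws of single nodes and of pairs of
  nodes, because the variance is determined by the mixed moments of second order.\<close>
lemma variance_le_monte_carlo_if_separated_pairs:
  fixes f :: "real ^ 'd::finite \<Rightarrow> real"
  assumes M: "prob_space M" and M': "prob_space M'" and N: "N \<ge> 1"
    and f: "square_integrable_on (half_open_cube 1) f"
    and mono: "monotone_in_each_coordinate_on (half_open_cube 1) f"
    and p: "\<And>j. j \<in> {1..N} \<Longrightarrow> uniform_lebesgue M (half_open_cube 1) (p j)"
    and pp: "\<And>j k. j \<in> {1..N} \<Longrightarrow> k \<in> {1..N} \<Longrightarrow> j \<noteq> k \<Longrightarrow>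
      uniform_lebesgue M (separated_pairs N) (\<lambda>\<omega>. (p j \<omega>, p k \<omega>))"
    and u: "monte_carlo_sample M' N u"
  shows "completed_variance M (quadrature N p f) \<le> completed_variance M' (quadrature N u f)"
proof -
  obtain g where g: "g \<in> borel_measurable borel"
    and fg: "AE x in lborel. x \<in> half_open_cube 1 \<longrightarrow> f x = g x"
    and sq: "integrable lborel (\<lambda>x. indicator (half_open_cube 1) x * (g x)\<^sup>2)"
    using square_integrable_borel_version[OF f] by blast
  note int = integrable_cube_of_square_integrable[OF g sq]
  have u': "uniform_lebesgue M' (half_open_cube 1) (u j)" if "j \<in> {1..N}" for j
    using u that by (auto simp: monte_carlo_sample_def)
  have "(LINT \<omega>|M. g (p j \<omega>) * g (p k \<omega>)) \<le> (LINT \<omega>|M'. g (u j \<omega>) * g (u k \<omega>))"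
    if jk: "j \<in> {1..N}" "k \<in> {1..N}" for j k
  proof (cases "j = k")
    case True
    then show ?thesis
      using uniform_cube_integral(2)[OF p[OF jk(1)], of "\<lambda>x. g x * g x"]
        uniform_cube_integral(2)[OF u'[OF jk(1)], of "\<lambda>x. g x * g x"] g by simp
  next
    case False
    with jk have "N \<ge> 2" by auto
    then show ?thesis
      using separated_pair_negatively_correlated[OF _ mono g fg int pp[OF jk False]]
        monte_carlo_expectation[OF M' u jk False g int] by simp
  qed
  then have "(\<Sum>j=1..N. \<Sum>k=1..N. LINT \<omega>|M. g (p j \<omega>) * g (p k \<omega>))
      \<le> (\<Sum>j=1..N. \<Sum>k=1..N. LINT \<omega>|M'. g (u j \<omega>) * g (u k \<omega>))"
    by (intro sum_mono)
  moreover note completed_variance_quadrature[OF M N g fg sq, of p]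
    completed_variance_quadrature[OF M' N g fg sq, of u]
  ultimately show ?thesis
    using p u' by (simp add: divide_right_mono)
qed

section \<open>Jittered designs\<close>

lemma measure_cell:
  "N \<ge> 1 \<Longrightarrow> measure lborel (cell N c :: (real ^ 'd::finite) set) = 1 / real N ^ CARD('d)"
  by (simp add: measure_def emeasure_cell)

lemma fmeasurable_cell: "N \<ge> 1 \<Longrightarrow> cell N c \<in> fmeasurable lborel"
  by (intro fmeasurableI) (simp_all add: emeasure_cell)

lemma measure_separated_pairs_Times:
  fixes P Q :: "(real ^ 'd::finite) set"
  assumes N: "N \<ge> 1" and PQ: "P \<in> sets borel" "Q \<in> sets borel"
  shows "measure lborel (separated_pairs N \<inter> P \<times> Q)
    = (\<Sum>(a, b)\<in>separated_cells N. measure lborel (cell N a \<inter> P) * measure lborel (cell N b \<inter> Q))"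
proof -
  have fm: "emeasure lborel (cell N c \<inter> P) = ennreal (measure lborel (cell N c \<inter> P))"
    if "P \<in> sets borel" for c :: "'d \<Rightarrow> nat" and P
    using fmeasurable_Int_fmeasurable[OF fmeasurable_cell[OF N]] that
    by (intro emeasure_eq_measure2) simp
  have "emeasure lborel (separated_pairs N \<inter> P \<times> Q)
      = ennreal (\<Sum>(a, b)\<in>separated_cells N. measure lborel (cell N a \<inter> P) * measure lborel (cell N b \<inter> Q))"
    unfolding emeasure_separated_pairs_Times[OF assms]
    by (simp add: fm PQ ennreal_mult[symmetric] split_beta sum_nonneg)
  then show ?thesis
    by (simp add: measure_def sum_nonneg split_beta)
qed

text \<open>
  The structure that lattices and Latin hypercube samples have in common. A discrete variable
  \<open>W\<close>, which takes each value in \<open>A\<close> with probability \<open>\<kappa>\<close>, decides which cell receives which node,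
  and \<open>X j c\<close> is the position of node \<open>j\<close> if its cell turns out to be \<open>c\<close>. The choice of cells and
  the positions of different nodes are independent, stated as a product rule for events; the
  case \<open>J = {}\<close> of the rule is the uniformity of \<open>W\<close>. The last assumption says that every separated
  pair of cells is occupied by \<open>(j, k)\<close> for equally many values of \<open>W\<close>.
\<close>
locale jittered_design = prob_space M for M :: "'w measure" +
  fixes N :: nat and A :: "'x set" and W :: "'w \<Rightarrow> 'x" and \<kappa> :: real
    and cell_of :: "nat \<Rightarrow> 'x \<Rightarrow> ('d::finite \<Rightarrow> nat)"
    and X :: "nat \<Rightarrow> ('d \<Rightarrow> nat) \<Rightarrow> 'w \<Rightarrow> real ^ 'd"
    and p :: "nat \<Rightarrow> 'w \<Rightarrow> real ^ 'd"
  assumes N: "N \<ge> 1"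
    and finite_A: "finite A"
    and W_in: "\<omega> \<in> space M \<Longrightarrow> W \<omega> \<in> A"
    and W_event: "w \<in> A \<Longrightarrow> {\<omega> \<in> space M. W \<omega> = w} \<in> events"
    and X_uniform: "j \<in> {1..N} \<Longrightarrow> c \<in> cells N \<Longrightarrow> uniform_lebesgue M (cell N c) (X j c)"
    and indep: "J \<subseteq> {1..N} \<Longrightarrow> w \<in> A \<Longrightarrow> (\<And>j. j \<in> J \<Longrightarrow> z j \<in> cells N) \<Longrightarrow>
      (\<And>j. j \<in> J \<Longrightarrow> P j \<in> sets borel) \<Longrightarrow>
      prob {\<omega> \<in> space M. W \<omega> = w \<and> (\<forall>j\<in>J. X j (z j) \<omega> \<in> P j)}
        = \<kappa> * (\<Prod>j\<in>J. prob {\<omega> \<in> space M. X j (z j) \<omega> \<in> P j})"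
    and p_eq: "j \<in> {1..N} \<Longrightarrow> \<omega> \<in> space M \<Longrightarrow> p j \<omega> = X j (cell_of j (W \<omega>)) \<omega>"
    and cell_of_in: "j \<in> {1..N} \<Longrightarrow> w \<in> A \<Longrightarrow> cell_of j w \<in> cells N"
    and separated: "j \<in> {1..N} \<Longrightarrow> k \<in> {1..N} \<Longrightarrow> j \<noteq> k \<Longrightarrow> w \<in> A \<Longrightarrow>
      (cell_of j w, cell_of k w) \<in> separated_cells N"
    and balanced: "j \<in> {1..N} \<Longrightarrow> k \<in> {1..N} \<Longrightarrow> j \<noteq> k \<Longrightarrow>
      (a, b) \<in> separated_cells N \<Longrightarrow> (a', b') \<in> separated_cells N \<Longrightarrow>
      card {w \<in> A. cell_of j w = a \<and> cell_of k w = b} = card {w \<in> A. cell_of j w = a' \<and> cell_of k w = b'}"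
begin

lemma X_measurable: "j \<in> {1..N} \<Longrightarrow> c \<in> cells N \<Longrightarrow> X j c \<in> borel_measurable M"
  using X_uniform by (simp add: uniform_lebesgue_def)

lemma joint_event:
  assumes "J \<subseteq> {1..N}" "w \<in> A" and P: "\<And>j. j \<in> J \<Longrightarrow> P j \<in> sets borel"
  shows "{\<omega> \<in> space M. W \<omega> = w \<and> (\<forall>j\<in>J. X j (cell_of j w) \<omega> \<in> P j)} \<in> events"
proof -
  have "finite J" using assms(1) finite_subset by blast
  have "{\<omega> \<in> space M. X j (cell_of j w) \<omega> \<in> P j} \<in> events" if "j \<in> J" for j
    using measurable_sets[OF X_measurable[OF _ cell_of_in] P[OF that]] assms that
    by (auto simp: vimage_def Int_def conj_commute)
  then have "{\<omega> \<in> space M. \<forall>j\<in>J. X j (cell_of j w) \<omega> \<in> P j} \<in> events"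
    using \<open>finite J\<close> by (rule sets.sets_Collect_finite_All)
  with W_event[OF assms(2)] have "{\<omega> \<in> space M. W \<omega> = w}
      \<inter> {\<omega> \<in> space M. \<forall>j\<in>J. X j (cell_of j w) \<omega> \<in> P j} \<in> events"
    by (rule sets.Int)
  also have "{\<omega> \<in> space M. W \<omega> = w} \<inter> {\<omega> \<in> space M. \<forall>j\<in>J. X j (cell_of j w) \<omega> \<in> P j}
      = {\<omega> \<in> space M. W \<omega> = w \<and> (\<forall>j\<in>J. X j (cell_of j w) \<omega> \<in> P j)}"
    by auto
  finally show ?thesis .
qed

lemma
  assumes J: "J \<subseteq> {1..N}" and P: "\<And>j. j \<in> J \<Longrightarrow> P j \<in> sets borel"
  shows nodes_event: "{\<omega> \<in> space M. \<forall>j\<in>J. p j \<omega> \<in> P j} \<in> events" (is "?E \<in> _")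
    and prob_nodes: "prob {\<omega> \<in> space M. \<forall>j\<in>J. p j \<omega> \<in> P j}
      = (\<Sum>w\<in>A. \<kappa> * (\<Prod>j\<in>J. real N ^ CARD('d) * measure lborel (cell N (cell_of j w) \<inter> P j)))"
proof -
  let ?F = "\<lambda>w. {\<omega> \<in> space M. W \<omega> = w \<and> (\<forall>j\<in>J. X j (cell_of j w) \<omega> \<in> P j)}"
  have E: "?E = (\<Union>w\<in>A. ?F w)"
    using W_in J by (auto simp: p_eq subset_iff)
  have F: "?F w \<in> events" if "w \<in> A" for w
    by (rule joint_event[OF J that P])
  then show "?E \<in> events"
    unfolding E by (intro sets.finite_UN finite_A)
  have single: "prob {\<omega> \<in> space M. X j c \<omega> \<in> P j} = real N ^ CARD('d) * measure lborel (cell N c \<inter> P j)"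
    if "j \<in> J" "c \<in> cells N" for j c
  proof -
    have j: "j \<in> {1..N}" using that J by auto
    have "prob {\<omega> \<in> space M. X j c \<omega> \<in> P j} = measure (distr M borel (X j c)) (P j)"
      using P that by (subst measure_distr[OF X_measurable[OF j that(2)]])
        (auto intro!: arg_cong[where f = prob])
    also have "distr M borel (X j c) = uniform_measure lborel (cell N c)"
      using X_uniform[OF j that(2)] by (simp add: uniform_lebesgue_def)
    also have "measure \<dots> (P j) = real N ^ CARD('d) * measure lborel (cell N c \<inter> P j)"
      using P that N by (subst measure_uniform_measure) (simp_all add: emeasure_cell measure_cell)
    finally show ?thesis .
  qed
  have "prob ?E = (\<Sum>w\<in>A. prob (?F w))"
    unfolding E using F by (intro finite_measure_finite_Union finite_A) (auto simp: disjoint_family_on_def)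
  also have "\<dots> = (\<Sum>w\<in>A. \<kappa> * (\<Prod>j\<in>J. real N ^ CARD('d) * measure lborel (cell N (cell_of j w) \<inter> P j)))"
  proof (rule sum.cong[OF refl])
    fix w assume w: "w \<in> A"
    have c: "cell_of j w \<in> cells N" if "j \<in> J" for j
      using cell_of_in w that J by auto
    have "prob (?F w) = \<kappa> * (\<Prod>j\<in>J. prob {\<omega> \<in> space M. X j (cell_of j w) \<omega> \<in> P j})"
      by (rule indep[OF J w c P])
    also have "\<dots> = \<kappa> * (\<Prod>j\<in>J. real N ^ CARD('d) * measure lborel (cell N (cell_of j w) \<inter> P j))"
      by (simp only: single c cong: prod.cong)
    finally show "prob (?F w) = \<dots>" .
  qed
  finally show "prob ?E = (\<Sum>w\<in>A. \<kappa> * (\<Prod>j\<in>J. real N ^ CARD('d) * measure lborel (cell N (cell_of j w) \<inter> P j)))" .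
qed

lemma p_measurable: "j \<in> {1..N} \<Longrightarrow> p j \<in> borel_measurable M"
  using nodes_event[of "{j}"] by (intro measurableI) (auto simp: vimage_def Int_def conj_commute)

text \<open>Every cell is separated from the same number \<open>(N - 1) ^ d\<close> of cells, so that equidistribution
  of pairs implies equidistribution of single cells. For \<open>N = 1\<close> there are no pairs,
  but then there is only one cell.\<close>
lemma balanced_single:
  assumes j: "j \<in> {1..N}" and c: "c \<in> cells N" "c' \<in> cells N"
  shows "card {w \<in> A. cell_of j w = c} = card {w \<in> A. cell_of j w = c'}"
proof (cases "N = 1")
  case True
  then have "c = c'" using c by (auto simp: cells_def fun_eq_iff)
  then show ?thesis by simp
next
  case False
  then obtain k where k: "k \<in> {1..N}" "k \<noteq> j"
    using N j by (metis One_nat_def atLeastAtMost_iff le_antisym le_refl nat_le_linear)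
  have "c \<in> cells N \<Longrightarrow> \<exists>b. (c, b) \<in> separated_cells N" for c :: "'d \<Rightarrow> nat"
    using card_separated_from[of c N] False N by (metis (mono_tags, lifting) One_nat_def card.empty diff_is_0_eq empty_Collect_eq le_antisym power_eq_0_iff)
  then obtain b0 where b0: "(c, b0) \<in> separated_cells N" using c by blast
  define n where "n = card {w \<in> A. cell_of j w = c \<and> cell_of k w = b0}"
  have "card {w \<in> A. cell_of j w = a} = (N - 1) ^ CARD('d) * n" if a: "a \<in> cells N" for a
  proof -
    have "{w \<in> A. cell_of j w = a}
        = (\<Union>b\<in>{b. (a, b) \<in> separated_cells N}. {w \<in> A. cell_of j w = a \<and> cell_of k w = b})"
      using separated[OF j k(1)] k(2) by auto
    also have "card \<dots> = (\<Sum>b | (a, b) \<in> separated_cells N. card {w \<in> A. cell_of j w = a \<and> cell_of k w = b})"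
      using finite_A by (intro card_UN_disjoint) auto
    also have "\<dots> = (\<Sum>b | (a, b) \<in> separated_cells N. n)"
      unfolding n_def using j k b0 by (intro sum.cong refl balanced) auto
    also have "\<dots> = (N - 1) ^ CARD('d) * n"
      by (simp add: card_separated_from[OF a])
    finally show ?thesis .
  qed
  with c show ?thesis by simp
qed

text \<open>The law of the node is a multiple of Lebesgue measure on the cube; the total mass
  determines the factor.\<close>
lemma node_uniform:
  assumes j: "j \<in> {1..N}"
  shows "uniform_lebesgue M (half_open_cube 1) (p j)"
proof -
  have fm: "cell N c \<inter> P \<in> fmeasurable lborel" if "P \<in> sets borel" for c :: "'d \<Rightarrow> nat" and P
    using fmeasurable_Int_fmeasurable[OF fmeasurable_cell[OF N]] that by simp
  define n where "n = card {w \<in> A. cell_of j w = (\<lambda>_. 0)}"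
  have n: "card {w \<in> A. cell_of j w = c} = n" if "c \<in> cells N" for c
    unfolding n_def using N that by (intro balanced_single[OF j]) (auto simp: cells_def)
  define C where "C = real n * \<kappa> * real N ^ CARD('d)"
  have law: "prob {\<omega> \<in> space M. p j \<omega> \<in> P} = C * measure lborel (half_open_cube 1 \<inter> P)"
    if P: "P \<in> sets borel" for P
  proof -
    have "prob {\<omega> \<in> space M. p j \<omega> \<in> P}
        = (\<Sum>w\<in>A. \<kappa> * real N ^ CARD('d) * measure lborel (cell N (cell_of j w) \<inter> P))"
      using prob_nodes[of "{j}" "\<lambda>_. P"] j P by (simp add: mult.assoc)
    also have "\<dots> = (\<Sum>c\<in>cells N. \<Sum>w | w \<in> A \<and> cell_of j w = c.
        \<kappa> * real N ^ CARD('d) * measure lborel (cell N (cell_of j w) \<inter> P))"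
      using finite_A cell_of_in[OF j] by (intro sum.group[symmetric]) auto
    also have "\<dots> = (\<Sum>c\<in>cells N. C * measure lborel (cell N c \<inter> P))"
      by (intro sum.cong refl) (simp add: n C_def)
    also have "\<dots> = C * (\<Sum>c\<in>cells N. measure lborel (cell N c \<inter> P))"
      by (simp add: sum_distrib_left)
    also have "(\<Sum>c\<in>cells N. measure lborel (cell N c \<inter> P)) = measure lborel (\<Union>c\<in>cells N. cell N c \<inter> P)"
    proof (rule measure_finite_Union[symmetric])
      show "emeasure lborel (cell N c \<inter> P) \<noteq> \<infinity>" for c :: "'d \<Rightarrow> nat"
        using fm[OF P, of c] by (simp add: fmeasurable_def less_top)
    qed (use P in \<open>auto simp: disjoint_family_on_def dest: cell_unique[OF N]\<close>)
    finally show ?thesis by (simp add: half_open_cube_eq_UN_cell[OF N])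
  qed
  have cube: "emeasure lborel (half_open_cube 1 :: (real ^ 'd) set) = 1"
    by (simp add: emeasure_half_open_cube)
  have "measure lborel (half_open_cube 1 :: (real ^ 'd) set) = 1"
    by (simp add: measure_def cube)
  then have "C = 1"
    using law[of UNIV] by (simp add: prob_space)
  have "distr M borel (p j) = uniform_measure lborel (half_open_cube 1)"
  proof (rule measure_eqI)
    fix P assume "P \<in> sets (distr M borel (p j))"
    then have P: "P \<in> sets borel" by simp
    have "half_open_cube 1 \<inter> P \<in> fmeasurable lborel"
    proof (rule fmeasurableI2)
      show "half_open_cube 1 \<in> fmeasurable (lborel :: (real ^ 'd) measure)"
        by (rule fmeasurableI) (simp_all add: cube)
    qed (use P in auto)
    then have "emeasure lborel (half_open_cube 1 \<inter> P) = ennreal (measure lborel (half_open_cube 1 \<inter> P))"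
      by (rule emeasure_eq_measure2)
    moreover have "emeasure (distr M borel (p j)) P = ennreal (prob {\<omega> \<in> space M. p j \<omega> \<in> P})"
      using P by (simp add: emeasure_distr[OF p_measurable[OF j]] emeasure_eq_measure vimage_def Int_def conj_commute)
    ultimately show "emeasure (distr M borel (p j)) P = emeasure (uniform_measure lborel (half_open_cube 1)) P"
      using P by (simp add: law \<open>C = 1\<close> cube divide_ennreal_def)
  qed simp
  then show ?thesis
    using p_measurable[OF j] by (simp add: uniform_lebesgue_def)
qed

text \<open>The same normalisation argument on the product space, where the two measures are compared on
  the generator of measurable rectangles.\<close>
lemma node_pair_uniform:
  assumes j: "j \<in> {1..N}" and k: "k \<in> {1..N}" and jk: "j \<noteq> k"
  shows "uniform_lebesgue M (separated_pairs N) (\<lambda>\<omega>. (p j \<omega>, p k \<omega>))"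
proof -
  let ?R = "separated_pairs N :: ((real ^ 'd) \<times> (real ^ 'd)) set"
  let ?Z = "\<lambda>\<omega>. (p j \<omega>, p k \<omega>)"
  \<comment> \<open>Any separated pair serves as reference; if there is none, the value is irrelevant.\<close>
  define ab0 :: "('d \<Rightarrow> nat) \<times> ('d \<Rightarrow> nat)" where "ab0 = (SOME ab. ab \<in> separated_cells N)"
  define n where "n = card {w \<in> A. cell_of j w = fst ab0 \<and> cell_of k w = snd ab0}"
  have n: "card {w \<in> A. cell_of j w = a \<and> cell_of k w = b} = n"
    if "(a, b) \<in> separated_cells N" for a b
  proof -
    have "ab0 \<in> separated_cells N"
      unfolding ab0_def using that by (rule someI)
    then show ?thesis
      unfolding n_def by (intro balanced[OF j k jk that]) simp
  qed
  define C where "C = real n * \<kappa> * (real N ^ CARD('d))\<^sup>2"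
  have law: "prob {\<omega> \<in> space M. p j \<omega> \<in> P \<and> p k \<omega> \<in> Q} = C * measure lborel (?R \<inter> P \<times> Q)"
    if PQ: "P \<in> sets borel" "Q \<in> sets borel" for P Q
  proof -
    let ?v = "\<lambda>ab. measure lborel (cell N (fst ab) \<inter> P) * measure lborel (cell N (snd ab) \<inter> Q)"
    have "prob {\<omega> \<in> space M. p j \<omega> \<in> P \<and> p k \<omega> \<in> Q}
        = (\<Sum>w\<in>A. \<kappa> * (real N ^ CARD('d))\<^sup>2 * ?v (cell_of j w, cell_of k w))"
      using prob_nodes[of "{j, k}" "\<lambda>i. if i = j then P else Q"] j k jk PQ
      by (simp add: power2_eq_square mult_ac)
    also have "\<dots> = (\<Sum>ab\<in>separated_cells N. \<Sum>w | w \<in> A \<and> (cell_of j w, cell_of k w) = ab.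
        \<kappa> * (real N ^ CARD('d))\<^sup>2 * ?v (cell_of j w, cell_of k w))"
      using finite_A separated[OF j k jk] by (intro sum.group[symmetric]) auto
    also have "\<dots> = (\<Sum>ab\<in>separated_cells N. C * ?v ab)"
    proof (rule sum.cong[OF refl])
      fix ab :: "('d \<Rightarrow> nat) \<times> ('d \<Rightarrow> nat)" assume "ab \<in> separated_cells N"
      then have "card {w. w \<in> A \<and> (cell_of j w, cell_of k w) = ab} = n"
        using n[of "fst ab" "snd ab"] by (cases ab) simp
      then show "(\<Sum>w | w \<in> A \<and> (cell_of j w, cell_of k w) = ab.
          \<kappa> * (real N ^ CARD('d))\<^sup>2 * ?v (cell_of j w, cell_of k w)) = C * ?v ab"
        by (subst sum.cong[OF refl, where h = "\<lambda>_. \<kappa> * (real N ^ CARD('d))\<^sup>2 * ?v ab"])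
           (auto simp only: mem_Collect_eq sum_constant C_def mult_ac)
    qed
    also have "\<dots> = C * measure lborel (?R \<inter> P \<times> Q)"
      by (simp add: measure_separated_pairs_Times[OF N PQ] sum_distrib_left split_beta)
    finally show ?thesis .
  qed
  have total: "C * measure lborel ?R = 1"
    using law[of UNIV UNIV] by (simp add: prob_space)
  then have "measure lborel ?R \<noteq> 0" by auto
  then have R: "emeasure lborel ?R = ennreal (measure lborel ?R)" "measure lborel ?R > 0"
    using N by (simp_all add: emeasure_separated_pairs[OF N] measure_def zero_less_measure_iff[symmetric])
  have Z [measurable]: "?Z \<in> borel_measurable M"
    using p_measurable[OF j] p_measurable[OF k] by (rule borel_measurable_Pair)
  have "distr M borel ?Z = uniform_measure lborel ?R"
  proof (rule measure_eqI_generator_eq)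
    let ?E = "{P \<times> Q | P Q. P \<in> sets (borel :: (real ^ 'd) measure) \<and> Q \<in> sets (borel :: (real ^ 'd) measure)}"
    show "Int_stable ?E" by (rule Int_stable_pair_measure_generator)
    show "?E \<subseteq> Pow UNIV" by simp
    have "sets (borel :: ((real ^ 'd) \<times> (real ^ 'd)) measure) = sigma_sets UNIV ?E"
      by (simp add: borel_prod[symmetric] sets_pair_measure)
    then show "sets (distr M borel ?Z) = sigma_sets UNIV ?E"
      "sets (uniform_measure lborel ?R) = sigma_sets UNIV ?E" by simp_all
    have "UNIV \<in> ?E"
      by (rule CollectI, rule exI[of _ UNIV], rule exI[of _ UNIV]) simp
    then show "range (\<lambda>_ :: nat. UNIV) \<subseteq> ?E" by (simp only: image_subset_iff simp_thms ball_UNIV)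
    show "(\<Union>i :: nat. UNIV) = (UNIV :: ((real ^ 'd) \<times> (real ^ 'd)) set)" by simp
    show "emeasure (distr M borel ?Z) UNIV \<noteq> \<infinity>" for i :: nat
      by (simp add: emeasure_distr)
    fix B assume "B \<in> ?E"
    then obtain P Q where B: "B = P \<times> Q" and PQ: "P \<in> sets borel" "Q \<in> sets borel" by blast
    have "?R \<inter> B \<in> fmeasurable lborel"
    proof (rule fmeasurableI2)
      show "?R \<in> fmeasurable lborel"
        by (rule fmeasurableI) (simp_all add: emeasure_separated_pairs[OF N])
    qed (use PQ in \<open>auto simp: B intro: borel_Times\<close>)
    then have m: "emeasure lborel (?R \<inter> B) = ennreal (measure lborel (?R \<inter> B))"
      by (rule emeasure_eq_measure2)
    have "?Z -` B \<inter> space M = {\<omega> \<in> space M. p j \<omega> \<in> P \<and> p k \<omega> \<in> Q}"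
      by (auto simp: B)
    then have "emeasure (distr M borel ?Z) B = ennreal (C * measure lborel (?R \<inter> B))"
      using PQ by (subst emeasure_distr) (auto simp: B emeasure_eq_measure law)
    also have "C = 1 / measure lborel ?R"
      using total R(2) by (simp add: field_simps)
    also have "ennreal (1 / measure lborel ?R * measure lborel (?R \<inter> B)) = emeasure (uniform_measure lborel ?R) B"
      using PQ R(2) by (subst emeasure_uniform_measure) (auto simp: m[unfolded B] R(1) divide_ennreal B)
    finally show "emeasure (distr M borel ?Z) B = emeasure (uniform_measure lborel ?R) B" .
  qed
  with Z show ?thesis by (simp add: uniform_lebesgue_def)
qed

end

section \<open>Transformations of uniform random variables\<close>

text \<open>An affine bijection scales all volumes by the same factor, which cancels in the quotient
  that defines the uniform measure.\<close>
lemma uniform_lebesgue_affine: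
  fixes A B :: "'a::euclidean_space set"
  assumes X: "uniform_lebesgue M A X" and s: "s \<noteq> 0"
    and AB: "A \<in> sets borel" "B \<in> sets borel" "\<And>x. t + s *\<^sub>R x \<in> B \<longleftrightarrow> x \<in> A"
  shows "uniform_lebesgue M B (\<lambda>\<omega>. t + s *\<^sub>R X \<omega>)"
proof -
  let ?T = "\<lambda>x. t + s *\<^sub>R x"
  let ?k = "ennreal (\<bar>s\<bar> ^ DIM('a))"
  have T [measurable]: "?T \<in> borel_measurable borel" by simp
  have X_meas [measurable]: "X \<in> borel_measurable M" and X_distr: "distr M borel X = uniform_measure lborel A"
    using X by (auto simp: uniform_lebesgue_def)
  have k: "?k \<noteq> 0" "?k \<noteq> \<infinity>" using s by auto
  have scale: "emeasure lborel C = ?k * emeasure lborel (?T -` C)" if [measurable]: "C \<in> sets borel" for C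
    by (subst lborel_affine[OF s, of t])
       (simp add: emeasure_density nn_integral_cmult_indicator emeasure_distr)
  have "distr M borel (\<lambda>\<omega>. ?T (X \<omega>)) = distr (distr M borel X) borel ?T"
    by (simp add: distr_distr comp_def)
  also have "\<dots> = uniform_measure lborel B"
  proof (rule measure_eqI)
    fix C assume "C \<in> sets (distr (distr M borel X) borel ?T)"
    then have C [measurable]: "C \<in> sets borel" by simp
    have TC: "?T -` C \<in> sets borel" using measurable_sets[OF T C] by simp
    have "emeasure (distr (distr M borel X) borel ?T) C = emeasure lborel (A \<inter> ?T -` C) / emeasure lborel A"
      using AB C TC by (subst emeasure_distr) (auto simp: X_distr)
    also have "\<dots> = (?k * emeasure lborel (A \<inter> ?T -` C)) / (?k * emeasure lborel A)"
      by (simp only: mult.commute[of ?k] divide_mult_eq[OF k])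
    also have "A \<inter> ?T -` C = ?T -` (B \<inter> C)" using AB(3) by auto
    also have "A = ?T -` B" using AB(3) by auto
    also have "(?k * emeasure lborel (?T -` (B \<inter> C))) / (?k * emeasure lborel (?T -` B))
        = emeasure (uniform_measure lborel B) C"
      unfolding scale[OF sets.Int[OF AB(2) C], symmetric] scale[OF AB(2), symmetric]
      using AB C by simp
    finally show "emeasure (distr (distr M borel X) borel ?T) C = emeasure (uniform_measure lborel B) C" .
  qed simp
  finally show ?thesis by (simp add: uniform_lebesgue_def)
qed

lemma uniform_lebesgue_cong_set:
  assumes "uniform_lebesgue M A X" and AB: "A \<in> sets borel" "B \<in> sets borel"
    and ae: "AE x in lborel. x \<in> A \<longleftrightarrow> x \<in> B"
  shows "uniform_lebesgue M B X"
proof -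
  have eq: "emeasure lborel (A \<inter> C) = emeasure lborel (B \<inter> C)" if "C \<in> sets borel" for C
    using AB that ae by (intro emeasure_eq_AE) auto
  have "uniform_measure lborel A = uniform_measure lborel B"
    by (rule measure_eqI) (use AB eq eq[of UNIV] in auto)
  then show ?thesis using assms(1) by (simp add: uniform_lebesgue_def)
qed

lemma uniform_lebesgue_cong_AE:
  assumes X: "uniform_lebesgue M A X" and Y: "Y \<in> borel_measurable M" and ae: "AE \<omega> in M. X \<omega> = Y \<omega>"
  shows "uniform_lebesgue M A Y"
proof -
  have "distr M borel X = distr M borel Y"
    using X Y ae by (intro distr_cong_AE) (auto simp: uniform_lebesgue_def)
  with X Y show ?thesis by (simp add: uniform_lebesgue_def)
qed

text \<open>The two laws agree on open boxes, where both are products over the coordinates.\<close>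
lemma (in prob_space) uniform_lebesgue_vector:
  fixes V :: "'d::finite \<Rightarrow> 'a \<Rightarrow> real" and A :: "'d \<Rightarrow> real set"
  assumes V: "\<And>i. uniform_lebesgue M (A i) (V i)"
    and A: "\<And>i. A i \<in> sets borel" "\<And>i. emeasure lborel (A i) = ennreal (v i)" "\<And>i. v i > 0"
    and indep: "\<And>B. (\<And>i. B i \<in> sets borel) \<Longrightarrow>
      prob {\<omega> \<in> space M. \<forall>i. V i \<omega> \<in> B i} = (\<Prod>i\<in>UNIV. prob {\<omega> \<in> space M. V i \<omega> \<in> B i})"
  shows "uniform_lebesgue M {x :: real ^ 'd. \<forall>i. x $ i \<in> A i} (\<lambda>\<omega>. \<chi> i. V i \<omega>)"
proof -
  let ?A = "{x :: real ^ 'd. \<forall>i. x $ i \<in> A i}" and ?V = "\<lambda>\<omega>. \<chi> i. V i \<omega>"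
  have V_meas: "V i \<in> borel_measurable M" for i
    using V[of i] by (simp add: uniform_lebesgue_def)
  have V' [measurable]: "?V \<in> borel_measurable M"
    by (rule borel_measurable_vecI) (simp add: V_meas)
  have A': "?A \<in> sets borel" by (rule sets_vec_box) (rule A)
  have single: "prob {\<omega> \<in> space M. V i \<omega> \<in> B} = measure lborel (A i \<inter> B) / v i"
    if B: "B \<in> sets borel" for i B
  proof -
    have "prob {\<omega> \<in> space M. V i \<omega> \<in> B} = measure (distr M borel (V i)) B"
      using B by (subst measure_distr[OF V_meas]) (auto intro!: arg_cong[where f = prob])
    also have "distr M borel (V i) = uniform_measure lborel (A i)"
      using V[of i] by (simp add: uniform_lebesgue_def)
    also have "measure \<dots> B = measure lborel (A i \<inter> B) / v i"
      using B A(3)[of i] by (subst measure_uniform_measure) (simp_all add: A(1,2) measure_def)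
    finally show ?thesis .
  qed
  have "distr M borel ?V = uniform_measure lborel ?A"
  proof (rule measure_eqI_generator_eq)
    let ?E = "range (\<lambda>(a, b). box a b :: (real ^ 'd) set)"
    show "Int_stable ?E" by (auto simp: Int_stable_def box_Int_box)
    show "?E \<subseteq> Pow UNIV" by simp
    show "sets (distr M borel ?V) = sigma_sets UNIV ?E" "sets (uniform_measure lborel ?A) = sigma_sets UNIV ?E"
      by (simp_all add: borel_eq_box)
    let ?U = "\<lambda>n::nat. box (- (real n *\<^sub>R One)) (real n *\<^sub>R One) :: (real ^ 'd) set"
    show "range ?U \<subseteq> ?E" "(\<Union>n. ?U n) = UNIV"
      unfolding UN_box_eq_UNIV by auto
    show "emeasure (distr M borel ?V) (?U n) \<noteq> \<infinity>" for n
      by (simp add: emeasure_distr)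
    fix S assume "S \<in> ?E"
    then obtain l u where S: "S = {x. \<forall>i. x $ i \<in> {l $ i<..<u $ i}}"
      by (auto simp: box_def Basis_vec_def inner_axis)
    let ?B = "\<lambda>i. {l $ i<..<u $ i}"
    have fin: "emeasure lborel (A i \<inter> ?B i) = ennreal (measure lborel (A i \<inter> ?B i))" for i
      using A by (intro emeasure_eq_measure2 fmeasurable_Int_fmeasurable fmeasurableI) auto
    have S_meas: "S \<in> sets borel" unfolding S by (rule sets_vec_box) simp
    have "emeasure (distr M borel ?V) S = ennreal (prob {\<omega> \<in> space M. \<forall>i. V i \<omega> \<in> ?B i})"
      using S_meas by (subst emeasure_distr[OF V']) (auto simp: S emeasure_eq_measure intro!: arg_cong[where f = prob])
    also have "\<dots> = ennreal (\<Prod>i\<in>UNIV. measure lborel (A i \<inter> ?B i) / v i)"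
      by (subst indep) (simp, simp only: single greaterThanLessThan_borel)
    also have "\<dots> = ennreal ((\<Prod>i\<in>UNIV. measure lborel (A i \<inter> ?B i)) / (\<Prod>i\<in>UNIV. v i))"
      by (simp add: prod_dividef)
    also have "\<dots> = ennreal (\<Prod>i\<in>UNIV. measure lborel (A i \<inter> ?B i)) / ennreal (\<Prod>i\<in>UNIV. v i)"
      using A(3) by (intro divide_ennreal[symmetric] prod_nonneg prod_pos) auto
    also have "\<dots> = (\<Prod>i\<in>UNIV. emeasure lborel (A i \<inter> ?B i)) / (\<Prod>i\<in>UNIV. emeasure lborel (A i))"
      using A(3) by (simp add: fin A(2) prod_ennreal less_imp_le)
    also have "\<dots> = emeasure lborel {x :: real ^ 'd. \<forall>i. x $ i \<in> A i \<inter> ?B i} / emeasure lborel ?A"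
      using A(1) by (subst (1 2) emeasure_lborel_vec_box) auto
    also have "{x :: real ^ 'd. \<forall>i. x $ i \<in> A i \<inter> ?B i} = ?A \<inter> S"
      by (auto simp: S)
    also have "emeasure lborel (?A \<inter> S) / emeasure lborel ?A = emeasure (uniform_measure lborel ?A) S"
      using A' S_meas by simp
    finally show "emeasure (distr M borel ?V) S = emeasure (uniform_measure lborel ?A) S" .
  qed
  with V' show ?thesis by (simp add: uniform_lebesgue_def)
qed

lemma (in prob_space) uniform_finite_event:
  assumes X: "uniform_finite M A X" and A: "finite A"
  shows "\<omega> \<in> space M \<Longrightarrow> X \<omega> \<in> A"
    and "a \<in> A \<Longrightarrow> {\<omega> \<in> space M. X \<omega> = a} \<in> events"
    and "a \<in> A \<Longrightarrow> prob {\<omega> \<in> space M. X \<omega> = a} = 1 / card A"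
    and "a \<in> A \<Longrightarrow> {\<omega> \<in> space M. X \<omega> = a} \<in> rv_events M (count_space A) X"
proof -
  have X_meas: "X \<in> M \<rightarrow>\<^sub>M count_space A" and X_distr: "distr M (count_space A) X = uniform_count_measure A"
    using X by (auto simp: uniform_finite_def)
  show "\<omega> \<in> space M \<Longrightarrow> X \<omega> \<in> A" using measurable_space[OF X_meas] by simp
  have eq: "X -` {a} \<inter> space M = {\<omega> \<in> space M. X \<omega> = a}" for a by auto
  assume a: "a \<in> A"
  then have sa: "{a} \<in> sets (count_space A)" by simp
  show "{\<omega> \<in> space M. X \<omega> = a} \<in> events"
    using measurable_sets[OF X_meas sa] by (simp add: eq)
  show "{\<omega> \<in> space M. X \<omega> = a} \<in> rv_events M (count_space A) X"
    unfolding rv_events_def eq[symmetric] using sa by blast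
  have "prob {\<omega> \<in> space M. X \<omega> = a} = measure (distr M (count_space A) X) {a}"
    using measure_distr[OF X_meas sa] by (simp add: eq)
  then show "prob {\<omega> \<in> space M. X \<omega> = a} = 1 / card A"
    using a A by (simp add: X_distr measure_uniform_count_measure)
qed

lemma Int_stable_rv_events:
  "Int_stable (rv_events M K X)"
proof (rule Int_stableI)
  fix a b assume "a \<in> rv_events M K X" "b \<in> rv_events M K X"
  then obtain A B where "A \<in> sets K" "B \<in> sets K" "a = X -` A \<inter> space M" "b = X -` B \<inter> space M"
    by (auto simp: rv_events_def)
  then have "a \<inter> b = X -` (A \<inter> B) \<inter> space M" "A \<inter> B \<in> sets K" by auto
  then show "a \<inter> b \<in> rv_events M K X" unfolding rv_events_def by blast
qed

section \<open>Latin hypercube samples\<close>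

lemma finite_permutations_upto [simp]: "finite (permutations N)"
  by (simp add: permutations_def finite_permutations)

lemma permutations_in: "\<pi> \<in> permutations N \<Longrightarrow> j \<in> {1..N} \<Longrightarrow> \<pi> j \<in> {1..N}"
  unfolding permutations_def mem_Collect_eq by (simp only: permutes_in_image)

lemma permutations_neq: "\<pi> \<in> permutations N \<Longrightarrow> j \<noteq> k \<Longrightarrow> \<pi> j \<noteq> \<pi> k"
  using permutes_inj[of \<pi> "{1..N}"] by (auto simp: permutations_def inj_def)

lemma permutation_moving_pair:
  assumes "a \<in> S" "b \<in> S" "a' \<in> S" "b' \<in> S" "a \<noteq> b" "a' \<noteq> b'"
  obtains \<tau> where "\<tau> permutes S" "\<tau> a = a'" "\<tau> b = b'"
proof
  let ?t = "Transposition.transpose a a'"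
  have t: "?t permutes S" using assms by (intro permutes_swap_id)
  then have "?t b \<in> S" using assms by (simp add: permutes_in_image)
  then show "Transposition.transpose (?t b) b' \<circ> ?t permutes S"
    using t assms by (intro permutes_compose permutes_swap_id)
  have "?t b \<noteq> a'"
    using assms by (metis transpose_apply_first transpose_eq_iff)
  then show "(Transposition.transpose (?t b) b' \<circ> ?t) a = a'"
    using assms by simp
  show "(Transposition.transpose (?t b) b' \<circ> ?t) b = b'" by simp
qed

text \<open>Composition with permutations that move \<open>a i\<close> to \<open>a' i\<close> and \<open>b i\<close> to \<open>b' i\<close> is an injection
  between the two families; these permutations exist because both pairs have different entries.
  Values of permutations lie in \<open>{1..N}\<close> and cells are counted from \<open>0\<close>, whence the shift by one.\<close>
lemma card_permutation_families_le:
  fixes a b a' b' :: "'d::finite \<Rightarrow> nat"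
  assumes jk: "j \<in> {1..N}" "k \<in> {1..N}"
    and ab: "(a, b) \<in> separated_cells N" and ab': "(a', b') \<in> separated_cells N"
  shows "card {w. (\<forall>i. w i \<in> permutations N) \<and> (\<lambda>i. w i j - 1) = a \<and> (\<lambda>i. w i k - 1) = b}
    \<le> card {w. (\<forall>i. w i \<in> permutations N) \<and> (\<lambda>i. w i j - 1) = a' \<and> (\<lambda>i. w i k - 1) = b'}"
    (is "card ?S \<le> card ?S'")
proof -
  have "\<exists>\<tau>. \<tau> permutes {1..N} \<and> \<tau> (Suc (a i)) = Suc (a' i) \<and> \<tau> (Suc (b i)) = Suc (b' i)" for i
  proof -
    have "Suc (a i) \<in> {1..N}" "Suc (b i) \<in> {1..N}" "Suc (a' i) \<in> {1..N}" "Suc (b' i) \<in> {1..N}"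
      "Suc (a i) \<noteq> Suc (b i)" "Suc (a' i) \<noteq> Suc (b' i)"
      using ab ab' by (auto simp: separated_cells_def cells_def Suc_le_eq)
    then show ?thesis by (meson permutation_moving_pair)
  qed
  then obtain \<tau> where \<tau>: "\<And>i. \<tau> i permutes {1..N}"
    "\<And>i. \<tau> i (Suc (a i)) = Suc (a' i)" "\<And>i. \<tau> i (Suc (b i)) = Suc (b' i)"
    by metis
  have fin: "finite ?S'"
  proof (rule finite_subset)
    show "?S' \<subseteq> PiE UNIV (\<lambda>_. permutations N)" by (auto simp: PiE_iff)
  qed (simp add: finite_PiE)
  show ?thesis
  proof (rule card_inj_on_le)
    show "inj_on (\<lambda>w i. \<tau> i \<circ> w i) ?S"
    proof (rule inj_onI)
      fix w w' :: "'d \<Rightarrow> nat \<Rightarrow> nat" assume eq: "(\<lambda>i. \<tau> i \<circ> w i) = (\<lambda>i. \<tau> i \<circ> w' i)"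
      show "w = w'"
      proof
        fix i
        have "\<tau> i \<circ> w i = \<tau> i \<circ> w' i" using eq by (rule fun_cong)
        then show "w i = w' i"
          using permutes_inj[OF \<tau>(1)[of i]] by (simp add: fun.inj_map_strong fun_eq_iff inj_eq)
      qed
    qed
    show "(\<lambda>w i. \<tau> i \<circ> w i) ` ?S \<subseteq> ?S'"
    proof safe
      fix w :: "'d \<Rightarrow> nat \<Rightarrow> nat"
      assume w: "\<forall>i. w i \<in> permutations N" and a: "a = (\<lambda>i. w i j - 1)" and b: "b = (\<lambda>i. w i k - 1)"
      have pos: "Suc (w i j - 1) = w i j" "Suc (w i k - 1) = w i k" for i
        using w jk permutations_in[of "w i" N j] permutations_in[of "w i" N k] by auto
      have "\<tau> i (w i j) = Suc (a' i)" "\<tau> i (w i k) = Suc (b' i)" for i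
        using \<tau>(2,3)[of i] by (simp_all only: a b pos)
      show "(\<tau> i \<circ> w i) \<in> permutations N" for i
        using w \<tau>(1)[of i] by (auto simp: permutations_def intro: permutes_compose)
      show "(\<lambda>i. (\<tau> i \<circ> w i) j - 1) = a'"
        using \<open>\<And>i. \<tau> i (w i j) = Suc (a' i)\<close> by simp
      show "(\<lambda>i. (\<tau> i \<circ> w i) k - 1) = b'"
        using \<open>\<And>i. \<tau> i (w i k) = Suc (b' i)\<close> by simp
    qed
  qed (rule fin)
qed

text \<open>The affine image of \<open>{0..<1}\<close> is open on the left and closed on the right, since the offset is
  subtracted. The two end points form a null set.\<close>
lemma uniform_stratum_coordinate:
  assumes N: "N \<ge> 1" and U: "uniform_lebesgue M {0..<1::real} U"
  shows "uniform_lebesgue M {real c / real N..<real (c + 1) / real N} (\<lambda>\<omega>. (real c + 1 - U \<omega>) / real N)"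
proof -
  have "uniform_lebesgue M {real c / real N<..real (c + 1) / real N}
      (\<lambda>\<omega>. (real c + 1) / real N + (- 1 / real N) *\<^sub>R U \<omega>)"
  proof (rule uniform_lebesgue_affine[OF U])
    fix x
    have "(real c + 1) / real N + (- 1 / real N) *\<^sub>R x = (real c + 1 - x) / real N"
      by (simp add: diff_divide_distrib)
    then show "(real c + 1) / real N + (- 1 / real N) *\<^sub>R x \<in> {real c / real N<..real (c + 1) / real N}
        \<longleftrightarrow> x \<in> {0..<1}"
      using N by (auto simp: divide_less_cancel divide_le_cancel)
  qed (use N in simp_all)
  then have "uniform_lebesgue M {real c / real N<..real (c + 1) / real N} (\<lambda>\<omega>. (real c + 1 - U \<omega>) / real N)"
    by (simp add: diff_divide_distrib)
  then show ?thesis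
  proof (rule uniform_lebesgue_cong_set)
    have "AE x in lborel. x \<notin> {real c / real N, real (c + 1) / real N}"
      by (rule AE_not_in) (simp add: finite_imp_null_set_lborel)
    then show "AE x in lborel. x \<in> {real c / real N<..real (c + 1) / real N}
        \<longleftrightarrow> x \<in> {real c / real N..<real (c + 1) / real N}"
      by eventually_elim auto
  qed simp_all
qed

text \<open>The discrete variable is the family of all coordinate permutations. The coordinates of one node
  come from different sources of randomness, so the independent sources are first grouped: one
  group for all permutations and one for the offsets of each node.\<close>
lemma latin_hypercube_design:
  fixes p :: "nat \<Rightarrow> 'w \<Rightarrow> real ^ 'd::finite"
  assumes "prob_space M" and N: "N \<ge> 1" and lhs: "latin_hypercube_sample M N p"
  shows "\<exists>A (W :: 'w \<Rightarrow> 'd \<Rightarrow> nat \<Rightarrow> nat) \<kappa> cell_of X. jittered_design M N A W \<kappa> cell_of X p"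
proof -
  interpret prob_space M by fact
  from lhs obtain \<pi> :: "'d \<Rightarrow> 'w \<Rightarrow> nat \<Rightarrow> nat" and U :: "nat \<Rightarrow> 'd \<Rightarrow> 'w \<Rightarrow> real"
    where \<pi>: "\<And>i. uniform_finite M (permutations N) (\<pi> i)"
      and U: "\<And>j i. j \<in> {1..N} \<Longrightarrow> uniform_lebesgue M {0..<1} (U j i)"
      and ind: "indep_sets (\<lambda>s. case s of
             Coord_Permutation i \<Rightarrow> rv_events M (count_space (permutations N)) (\<pi> i)
           | Offset j i \<Rightarrow> rv_events M borel (U j i))
          (range Coord_Permutation \<union> {Offset j i | j i. j \<in> {1..N}})" (is "indep_sets ?E ?I")
      and p: "\<And>j \<omega>. j \<in> {1..N} \<Longrightarrow> \<omega> \<in> space M \<Longrightarrow> p j \<omega> = (\<chi> i. (real (\<pi> i \<omega> j) - U j i \<omega>) / real N)"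
    unfolding latin_hypercube_sample_def by blast
  define A :: "('d \<Rightarrow> nat \<Rightarrow> nat) set" where "A = {w. \<forall>i. w i \<in> permutations N}"
  define W where "W \<omega> = (\<lambda>i. \<pi> i \<omega>)" for \<omega>
  define \<kappa> where "\<kappa> = (1 / real (card (permutations N))) ^ CARD('d)"
  define cell_of where "cell_of j w = (\<lambda>i. w i j - 1)" for j and w :: "'d \<Rightarrow> nat \<Rightarrow> nat"
  define X :: "nat \<Rightarrow> ('d \<Rightarrow> nat) \<Rightarrow> 'w \<Rightarrow> real ^ 'd"
    where "X j c \<omega> = (\<chi> i. (real (c i) + 1 - U j i \<omega>) / real N)" for j c \<omega>
  define group :: "nat option \<Rightarrow> 'd lhs_source set"
    where "group s = (case s of None \<Rightarrow> range Coord_Permutation | Some j \<Rightarrow> range (Offset j))" for s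
  define G where "G s = sigma (space M) (\<Union>e\<in>group s. ?E e)" for s
  have E_sub: "(\<Union>e\<in>group s. ?E e) \<subseteq> Pow (space M)" for s
    by (auto simp: rv_events_def split: lhs_source.splits)
  have space_G: "space (G s) = space M"
    and sets_G: "sets (G s) = sigma_sets (space M) (\<Union>e\<in>group s. ?E e)" for s
    unfolding G_def using E_sub by (simp_all add: space_measure_of sets_measure_of)
  have in_G: "B \<in> sets (G s)" if "e \<in> group s" "B \<in> ?E e" for e B s
    unfolding sets_G using that by blast
  have ind_G: "indep_sets (\<lambda>s. sets (G s)) (insert None (Some ` {1..N}))"
    unfolding sets_G
  proof (rule indep_sets_collect_sigma)
    have "(\<Union>s\<in>insert None (Some ` {1..N}). group s) = ?I"
      by (auto simp: group_def)
    then show "indep_sets ?E (\<Union>s\<in>insert None (Some ` {1..N}). group s)"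
      using ind by (simp only:)
    show "Int_stable (?E e)" for e
      by (cases e) (simp_all add: Int_stable_rv_events)
    show "disjoint_family_on group (insert None (Some ` {1..N}))"
      by (auto simp: disjoint_family_on_def group_def)
  qed
  have W_G: "{\<omega> \<in> space M. W \<omega> = w} \<in> sets (G None)" if w: "w \<in> A" for w
  proof -
    have "{\<omega> \<in> space (G None). \<pi> i \<omega> = w i} \<in> sets (G None)" for i
      using uniform_finite_event(4)[OF \<pi>, of "w i" i] w
      by (intro in_G[of "Coord_Permutation i"]) (auto simp: group_def space_G A_def)
    then have "{\<omega> \<in> space (G None). \<forall>i\<in>UNIV. \<pi> i \<omega> = w i} \<in> sets (G None)"
      by (intro sets.sets_Collect_finite_All) auto
    then show ?thesis by (simp add: space_G W_def fun_eq_iff)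
  qed
  have X_G: "X j c \<in> borel_measurable (G (Some j))" for j c
  proof -
    have [measurable]: "U j i \<in> borel_measurable (G (Some j))" for i
    proof (rule measurableI)
      fix B :: "real set" assume "B \<in> sets borel"
      then show "U j i -` B \<inter> space (G (Some j)) \<in> sets (G (Some j))"
        by (intro in_G[of "Offset j i"]) (auto simp: group_def space_G rv_events_def)
    qed simp
    show ?thesis
      unfolding X_def by (rule borel_measurable_vecI) simp
  qed
  have G_events: "B \<in> events" if "s \<in> insert None (Some ` {1..N})" "B \<in> sets (G s)" for s B
    using ind_G that unfolding indep_sets_def by blast
  have W_prob: "prob {\<omega> \<in> space M. W \<omega> = w} = \<kappa>" if w: "w \<in> A" for w
  proof -
    let ?e = "\<lambda>s. case s of Coord_Permutation i \<Rightarrow> {\<omega> \<in> space M. \<pi> i \<omega> = w i} | Offset j i \<Rightarrow> {}"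
    have "{\<omega> \<in> space M. W \<omega> = w} = (\<Inter>s\<in>range Coord_Permutation. ?e s)"
      by (auto simp: W_def fun_eq_iff)
    also have "prob \<dots> = (\<Prod>s\<in>range Coord_Permutation. prob (?e s))"
      using uniform_finite_event(4)[OF \<pi>] w by (intro indep_setsD[OF ind]) (auto simp: A_def)
    also have "\<dots> = (\<Prod>i\<in>UNIV. prob {\<omega> \<in> space M. \<pi> i \<omega> = w i})"
      by (subst prod.reindex) (auto simp: inj_on_def)
    also have "\<dots> = \<kappa>"
      using uniform_finite_event(3)[OF \<pi>] w by (simp add: A_def \<kappa>_def)
    finally show ?thesis .
  qed
  have X_unif: "uniform_lebesgue M (cell N c) (X j c)" if j: "j \<in> {1..N}" for j c
    unfolding X_def cell_def
  proof (rule uniform_lebesgue_vector)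
    show "uniform_lebesgue M {real (c i) / real N..<real (c i + 1) / real N}
        (\<lambda>\<omega>. (real (c i) + 1 - U j i \<omega>) / real N)" for i
      by (rule uniform_stratum_coordinate[OF N U[OF j]])
    show "emeasure lborel {real (c i) / real N..<real (c i + 1) / real N} = ennreal (1 / real N)" for i
      by (subst emeasure_lborel_Ico) (simp_all add: divide_right_mono diff_divide_distrib[symmetric])
    fix B :: "'d \<Rightarrow> real set" assume B: "\<And>i. B i \<in> sets borel"
    let ?V = "\<lambda>i \<omega>. (real (c i) + 1 - U j i \<omega>) / real N"
    let ?e = "\<lambda>s. case s of Coord_Permutation i \<Rightarrow> {} | Offset j i \<Rightarrow> {\<omega> \<in> space M. ?V i \<omega> \<in> B i}"
    have ev: "{\<omega> \<in> space M. ?V i \<omega> \<in> B i} \<in> rv_events M borel (U j i)" for i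
    proof -
      have "(\<lambda>x. (real (c i) + 1 - x) / real N) \<in> borel_measurable borel" by measurable
      from measurable_sets[OF this B[of i]]
      have "(\<lambda>x. (real (c i) + 1 - x) / real N) -` B i \<in> sets borel" by simp
      moreover have "{\<omega> \<in> space M. ?V i \<omega> \<in> B i}
          = U j i -` ((\<lambda>x. (real (c i) + 1 - x) / real N) -` B i) \<inter> space M" by auto
      ultimately show ?thesis unfolding rv_events_def by blast
    qed
    have "{\<omega> \<in> space M. \<forall>i. ?V i \<omega> \<in> B i} = (\<Inter>s\<in>range (Offset j). ?e s)" by auto
    also have "prob \<dots> = (\<Prod>s\<in>range (Offset j). prob (?e s))"
      using ev j by (intro indep_setsD[OF ind]) auto
    also have "\<dots> = (\<Prod>i\<in>UNIV. prob {\<omega> \<in> space M. ?V i \<omega> \<in> B i})"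
      by (subst prod.reindex) (auto simp: inj_on_def)
    finally show "prob {\<omega> \<in> space M. \<forall>i. ?V i \<omega> \<in> B i} = (\<Prod>i\<in>UNIV. prob {\<omega> \<in> space M. ?V i \<omega> \<in> B i})" .
  qed (use N in simp_all)
  have perm_range: "w i j \<in> {1..N}" if "w \<in> A" "j \<in> {1..N}" for w i j
    using that by (simp only: permutations_in[of "w i" N j] A_def mem_Collect_eq)
  have W_A: "W \<omega> \<in> A" if "\<omega> \<in> space M" for \<omega>
    using uniform_finite_event(1)[OF \<pi> _ that] by (simp add: A_def W_def)
  have "jittered_design M N A W \<kappa> cell_of X p"
  proof unfold_locales
    show "N \<ge> 1" by fact
    show "finite A"
    proof (rule finite_subset)
      show "A \<subseteq> PiE UNIV (\<lambda>_. permutations N)" by (auto simp: A_def PiE_iff)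
    qed (simp add: finite_PiE)
    show "W \<omega> \<in> A" if "\<omega> \<in> space M" for \<omega> by (rule W_A[OF that])
    show "{\<omega> \<in> space M. W \<omega> = w} \<in> events" if "w \<in> A" for w
      using W_G[OF that] by (rule G_events[rotated]) simp
    show "uniform_lebesgue M (cell N c) (X j c)" if "j \<in> {1..N}" for j c
      by (rule X_unif[OF that])
    show "prob {\<omega> \<in> space M. W \<omega> = w \<and> (\<forall>j\<in>J. X j (z j) \<omega> \<in> P j)}
        = \<kappa> * (\<Prod>j\<in>J. prob {\<omega> \<in> space M. X j (z j) \<omega> \<in> P j})"
      if J: "J \<subseteq> {1..N}" and w: "w \<in> A" and P: "\<And>j. j \<in> J \<Longrightarrow> P j \<in> sets borel" for J w z P
    proof -
      let ?e = "\<lambda>s. case s of None \<Rightarrow> {\<omega> \<in> space M. W \<omega> = w} | Some j \<Rightarrow> {\<omega> \<in> space M. X j (z j) \<omega> \<in> P j}"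
      have J_fin: "finite J" using J finite_subset by blast
      have XP: "{\<omega> \<in> space M. X j (z j) \<omega> \<in> P j} \<in> sets (G (Some j))" if "j \<in> J" for j
        using measurable_sets[OF X_G[of j "z j"] P[OF that]] by (simp add: vimage_def Int_def conj_commute space_G)
      have "{\<omega> \<in> space M. W \<omega> = w \<and> (\<forall>j\<in>J. X j (z j) \<omega> \<in> P j)} = (\<Inter>s\<in>insert None (Some ` J). ?e s)"
        by auto
      also have "prob \<dots> = (\<Prod>s\<in>insert None (Some ` J). prob (?e s))"
        using J J_fin W_G[OF w] XP by (intro indep_setsD[OF ind_G]) auto
      also have "\<dots> = \<kappa> * (\<Prod>j\<in>J. prob {\<omega> \<in> space M. X j (z j) \<omega> \<in> P j})"
        using J_fin by (subst prod.insert) (auto simp: prod.reindex W_prob[OF w])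
      finally show ?thesis .
    qed
    show "p j \<omega> = X j (cell_of j (W \<omega>)) \<omega>" if "j \<in> {1..N}" "\<omega> \<in> space M" for j \<omega>
    proof -
      have "real (\<pi> i \<omega> j) = real (\<pi> i \<omega> j - 1) + 1" for i
        using perm_range[OF W_A[OF that(2)] that(1), of i] by (simp add: W_def)
      then show ?thesis by (simp add: p[OF that] X_def cell_of_def W_def)
    qed
    show "cell_of j w \<in> cells N" if "j \<in> {1..N}" "w \<in> A" for j w
    proof -
      have "w i j - 1 < N" for i
        using perm_range[OF that(2,1), of i] by auto
      then show ?thesis by (simp add: cells_def cell_of_def)
    qed
    then show "(cell_of j w, cell_of k w) \<in> separated_cells N"
      if "j \<in> {1..N}" "k \<in> {1..N}" "j \<noteq> k" "w \<in> A" for j k w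
    proof -
      have "w i j \<noteq> w i k" for i
        using that permutations_neq[of "w i" N] by (simp add: A_def)
      moreover have "w i j \<ge> 1" "w i k \<ge> 1" for i
        using perm_range[OF that(4)] that by force+
      ultimately have "cell_of j w i \<noteq> cell_of k w i" for i
        unfolding cell_of_def by (metis le_add_diff_inverse2)
      with \<open>\<And>w j. j \<in> {1..N} \<Longrightarrow> w \<in> A \<Longrightarrow> cell_of j w \<in> cells N\<close> that show ?thesis
        by (simp add: separated_cells_def)
    qed
    show "card {w \<in> A. cell_of j w = a \<and> cell_of k w = b} = card {w \<in> A. cell_of j w = a' \<and> cell_of k w = b'}"
      if "j \<in> {1..N}" "k \<in> {1..N}" "(a, b) \<in> separated_cells N" "(a', b') \<in> separated_cells N" for j k a b a' b'
      using card_permutation_families_le[OF that] card_permutation_families_le[OF that(1,2,4,3)]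
      by (simp add: A_def cell_of_def)
  qed
  then show ?thesis by blast
qed

section \<open>Randomly shifted and jittered rank-1 lattices\<close>

lemma dvd_diff_small_eq:
  fixes x x' N :: nat
  assumes "int N dvd int x - int x'" "x < N" "x' < N"
  shows "x = x'"
proof -
  have "\<bar>int x - int x'\<bar> < int N" using assms by auto
  then show ?thesis
    using dvd_imp_le_int[OF _ assms(1)] by fastforce
qed

text \<open>In the field with \<open>N\<close> elements, the difference \<open>(m - n) x\<close> of the two values determines \<open>x\<close>,
  hence also \<open>y\<close>, and it vanishes only for \<open>x = 0\<close>. So the map is injective and avoids the
  diagonal; it is onto because both sides have \<open>N (N - 1)\<close> elements.\<close>
lemma lattice_pair_bij:
  fixes N m n :: nat
  assumes N: "prime N" and mn: "m < N" "n < N" "m \<noteq> n"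
  shows "bij_betw (\<lambda>(x, y). ((m * x + y) mod N, (n * x + y) mod N))
    ({1..<N} \<times> {..<N}) {(a, b). a < N \<and> b < N \<and> a \<noteq> b}" (is "bij_betw ?L ?D ?R")
proof -
  have N0: "N > 0" using N by (simp add: prime_gt_0_nat)
  have eqD: "x = x' \<and> y = y'"
    if "(m * x + y) mod N = (m * x' + y') mod N" "(n * x + y) mod N = (n * x' + y') mod N"
      "x < N" "x' < N" "y < N" "y' < N" for x y x' y'
  proof -
    have d: "int N dvd (int m * int x + int y) - (int m * int x' + int y')"
      "int N dvd (int n * int x + int y) - (int n * int x' + int y')"
      using that(1,2)[THEN arg_cong[where f = int]]
      by (simp_all add: zmod_int mod_eq_dvd_iff)
    from dvd_diff[OF d] have "int N dvd (int m - int n) * (int x - int x')"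
      by (simp add: algebra_simps)
    then have "int N dvd int m - int n \<or> int N dvd int x - int x'"
      using N by (simp add: prime_dvd_mult_iff)
    with dvd_diff_small_eq[OF _ mn(1,2)] mn(3) have "int N dvd int x - int x'" by blast
    then have "x = x'" using that by (intro dvd_diff_small_eq)
    with d(1) have "int N dvd int y - int y'" by simp
    with \<open>x = x'\<close> that show ?thesis using dvd_diff_small_eq by blast
  qed
  have inj: "inj_on ?L ?D"
  proof (rule inj_onI)
    fix v v' assume v: "v \<in> ?D" "v' \<in> ?D" "?L v = ?L v'"
    obtain x y x' y' where "v = (x, y)" "v' = (x', y')" by (cases v; cases v')
    with v eqD[of x y x' y'] show "v = v'" by simp
  qed
  have sub: "?L ` ?D \<subseteq> ?R"
  proof (rule image_subsetI)
    fix v assume "v \<in> ?D"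
    then obtain x y where v: "v = (x, y)" and x: "1 \<le> x" "x < N" and y: "y < N" by auto
    have "(m * x + y) mod N \<noteq> (n * x + y) mod N"
    proof
      assume "(m * x + y) mod N = (n * x + y) mod N"
      then have "int N dvd (int m * int x + int y) - (int n * int x + int y)"
        by (metis mod_eq_dvd_iff of_nat_add of_nat_mult of_nat_mod)
      then have "int N dvd (int m - int n) * (int x - int 0)"
        by (simp add: algebra_simps)
      then have "int N dvd int m - int n \<or> int N dvd int x - int 0"
        using N by (simp add: prime_dvd_mult_iff)
      with dvd_diff_small_eq[OF _ mn(1,2)] mn(3) dvd_diff_small_eq[of N x 0] x N0 show False by auto
    qed
    then show "?L v \<in> ?R" using N0 by (simp add: v)
  qed
  have "?R = (SIGMA a:{..<N}. {..<N} - {a})" by auto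
  then have R: "finite ?R" "card ?R = N * (N - 1)"
    by simp_all
  have "?L ` ?D = ?R"
  proof (rule card_subset_eq[OF R(1) sub])
    show "card (?L ` ?D) = card ?R"
      using inj by (simp add: card_image R(2) mult.commute)
  qed
  with inj show ?thesis by (simp add: bij_betw_def)
qed

definition grid_index :: "nat \<Rightarrow> real ^ 'd \<Rightarrow> 'd \<Rightarrow> nat" where
  "grid_index N x i = nat \<lfloor>real N * x $ i\<rfloor>"

definition grid_vector :: "nat \<Rightarrow> ('d \<Rightarrow> nat) \<Rightarrow> real ^ 'd" where
  "grid_vector N c = (\<chi> i. real (c i) / real N)"

lemma grid_index_vector [simp]: "N \<ge> 1 \<Longrightarrow> grid_index N (grid_vector N c) = c"
  by (simp add: grid_index_def grid_vector_def fun_eq_iff)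

lemma grid_eq_image: "(grid N :: (real ^ 'd::finite) set) = grid_vector N ` {c. \<forall>i. c i \<in> {..<N}}"
proof safe
  fix x :: "real ^ 'd" assume "x \<in> grid N"
  then have "\<forall>i. \<exists>k. k \<in> {0..<N} \<and> x $ i = real k / real N" unfolding grid_def by blast
  then obtain c where "\<And>i. c i \<in> {0..<N}" "\<And>i. x $ i = real (c i) / real N" by metis
  then show "x \<in> grid_vector N ` {c. \<forall>i. c i \<in> {..<N}}"
    by (intro image_eqI[of _ _ c]) (auto simp: grid_vector_def vec_eq_iff)
qed (auto simp: grid_def grid_vector_def Bex_def)

lemma grid_nonzero_eq_image: "(grid_nonzero N :: (real ^ 'd::finite) set) = grid_vector N ` {c. \<forall>i. c i \<in> {1..<N}}"
proof safe
  fix x :: "real ^ 'd" assume "x \<in> grid_nonzero N"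
  then have "\<forall>i. \<exists>k. k \<in> {1..<N} \<and> x $ i = real k / real N" unfolding grid_nonzero_def by blast
  then obtain c where "\<And>i. c i \<in> {1..<N}" "\<And>i. x $ i = real (c i) / real N" by metis
  then show "x \<in> grid_vector N ` {c. \<forall>i. c i \<in> {1..<N}}"
    by (intro image_eqI[of _ _ c]) (auto simp: grid_vector_def vec_eq_iff)
next
  fix c :: "'d \<Rightarrow> nat" assume "\<forall>i. c i \<in> {1..<N}"
  then show "grid_vector N c \<in> grid_nonzero N"
    unfolding grid_nonzero_def grid_vector_def by (auto intro!: bexI)
qed

lemma finite_grid [simp]: "finite (grid N :: (real ^ 'd::finite) set)"
proof -
  have "{c :: 'd \<Rightarrow> nat. \<forall>i. c i \<in> {..<N}} = PiE UNIV (\<lambda>_. {..<N})" by (auto simp: PiE_iff)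
  then show ?thesis unfolding grid_eq_image by (intro finite_imageI) (simp add: finite_PiE)
qed

lemma finite_grid_nonzero [simp]: "finite (grid_nonzero N :: (real ^ 'd::finite) set)"
  by (rule finite_subset[OF _ finite_grid[of N]]) (auto simp: grid_eq_image grid_nonzero_eq_image)

lemma frac_cong: "x - y \<in> \<int> \<Longrightarrow> frac x = frac y" for x y :: real
  by (metis frac_add_int_right add.commute diff_add_cancel)

lemma vec_frac_nth: "vec_frac x $ i = frac (x $ i)"
  by (simp add: vec_frac_def)

lemma borel_measurable_vec_frac [measurable]:
  "(vec_frac :: real ^ 'd::finite \<Rightarrow> _) \<in> borel_measurable borel"
proof (rule borel_measurable_vecI)
  fix i :: 'd
  have "(\<lambda>x :: real ^ 'd. x $ i - of_int \<lfloor>x $ i\<rfloor>) \<in> borel_measurable borel"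
    by measurable
  then show "(\<lambda>x :: real ^ 'd. vec_frac x $ i) \<in> borel_measurable borel"
    by (simp add: vec_frac_nth frac_def)
qed

text \<open>The indices of the grid point \<open>lattice_point \<gamma> (\<pi> j) + \<sigma>\<close> reduced modulo one, computed with
  integers modulo \<open>N\<close> instead of reals modulo one.\<close>
definition lattice_cell :: "nat \<Rightarrow> nat \<Rightarrow> (real ^ 'd) \<times> (real ^ 'd) \<times> (nat \<Rightarrow> nat) \<Rightarrow> 'd \<Rightarrow> nat" where
  "lattice_cell N j = (\<lambda>(\<gamma>, \<sigma>, \<pi>) i. ((\<pi> j - 1) * grid_index N \<gamma> i + grid_index N \<sigma> i) mod N)"

text \<open>The two arguments differ by an integer in every coordinate: by the quotient of the division by
  \<open>N\<close> on the one hand and by the integer part removed in \<open>lattice_point\<close> on the other.\<close>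
lemma lattice_node_eq:
  assumes N: "N \<ge> 1" and "\<gamma> \<in> grid_nonzero N" "\<sigma> \<in> grid N"
  shows "vec_frac (lattice_point \<gamma> (\<pi> j) + \<sigma> + x)
    = vec_frac (grid_vector N (lattice_cell N j (\<gamma>, \<sigma>, \<pi>)) + x)"
proof -
  obtain c s where c: "\<gamma> = grid_vector N c" and s: "\<sigma> = grid_vector N s"
    using assms by (auto simp: grid_eq_image grid_nonzero_eq_image)
  have "frac (frac (real (\<pi> j - 1) * (real (c i) / real N)) + real (s i) / real N + x $ i)
      = frac (real (((\<pi> j - 1) * c i + s i) mod N) / real N + x $ i)" for i
  proof (rule frac_cong)
    let ?k = "(\<pi> j - 1) * c i + s i"
    let ?y = "real (\<pi> j - 1) * (real (c i) / real N)"
    have "real ?k = real (?k div N) * real N + real (?k mod N)"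
      by (metis div_mult_mod_eq of_nat_add of_nat_mult)
    then have "?y + real (s i) / real N = real (?k div N) + real (?k mod N) / real N"
      using N by (simp add: field_simps)
    then have "frac ?y + real (s i) / real N + x $ i - (real (?k mod N) / real N + x $ i)
        = of_int (int (?k div N) - \<lfloor>?y\<rfloor>)"
      by (simp add: frac_def)
    then show "frac ?y + real (s i) / real N + x $ i - (real (?k mod N) / real N + x $ i) \<in> \<int>"
      by (simp only: Ints_of_int)
  qed
  then show ?thesis
    using N by (simp add: vec_eq_iff vec_frac_nth lattice_point_def lattice_cell_def c s)
      (simp add: grid_vector_def)
qed

text \<open>For each permutation exactly one generator and one shift place the nodes \<open>j\<close> and \<open>k\<close> in the
  prescribed cells.\<close>
lemma card_lattice_sources:
  fixes a b :: "'d::finite \<Rightarrow> nat"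
  assumes N: "prime N" and jk: "j \<in> {1..N}" "k \<in> {1..N}" "j \<noteq> k"
    and ab: "(a, b) \<in> separated_cells N"
  shows "card {w \<in> grid_nonzero N \<times> grid N \<times> permutations N. lattice_cell N j w = a \<and> lattice_cell N k w = b}
    = card (permutations N)"
proof -
  let ?S = "{w \<in> grid_nonzero N \<times> grid N \<times> permutations N. lattice_cell N j w = a \<and> lattice_cell N k w = b}"
  have N1: "N \<ge> 1" using N by (rule prime_ge_1_nat)
  have \<pi>_mn: "\<pi> j - 1 < N" "\<pi> k - 1 < N" "\<pi> j - 1 \<noteq> \<pi> k - 1" if "\<pi> \<in> permutations N" for \<pi>
  proof -
    have "\<pi> j \<in> {1..N}" "\<pi> k \<in> {1..N}" "\<pi> j \<noteq> \<pi> k"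
      using permutations_in[OF that] permutations_neq[OF that] jk by auto
    then show "\<pi> j - 1 < N" "\<pi> k - 1 < N" "\<pi> j - 1 \<noteq> \<pi> k - 1" by auto
  qed
  note bij = lattice_pair_bij[OF N \<pi>_mn]
  have inj: "inj_on (snd \<circ> snd) ?S"
  proof (rule inj_onI, clarsimp)
    fix \<gamma> \<sigma> \<gamma>' \<sigma>' :: "real ^ 'd" and \<pi>
    assume g: "\<gamma> \<in> grid_nonzero N" "\<sigma> \<in> grid N" "\<gamma>' \<in> grid_nonzero N" "\<sigma>' \<in> grid N"
      and \<pi>: "\<pi> \<in> permutations N"
      and eq: "lattice_cell N j (\<gamma>', \<sigma>', \<pi>) = lattice_cell N j (\<gamma>, \<sigma>, \<pi>)"
        "lattice_cell N k (\<gamma>', \<sigma>', \<pi>) = lattice_cell N k (\<gamma>, \<sigma>, \<pi>)"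
    obtain x y x' y' where xy: "\<gamma> = grid_vector N x" "\<sigma> = grid_vector N y"
        "\<gamma>' = grid_vector N x'" "\<sigma>' = grid_vector N y'"
      and r: "\<And>i. x i \<in> {1..<N}" "\<And>i. x' i \<in> {1..<N}" "\<And>i. y i \<in> {..<N}" "\<And>i. y' i \<in> {..<N}"
      using g unfolding grid_eq_image grid_nonzero_eq_image by blast
    have "(x i, y i) = (x' i, y' i)" for i
    proof (rule inj_onD[OF bij_betw_imp_inj_on[OF bij[OF \<pi> \<pi> \<pi>]]])
      show "(case (x i, y i) of (x, y) \<Rightarrow> (((\<pi> j - 1) * x + y) mod N, ((\<pi> k - 1) * x + y) mod N))
          = (case (x' i, y' i) of (x, y) \<Rightarrow> (((\<pi> j - 1) * x + y) mod N, ((\<pi> k - 1) * x + y) mod N))"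
        using fun_cong[OF eq(1), of i] fun_cong[OF eq(2), of i] N1 by (simp add: xy lattice_cell_def)
    qed (use r in auto)
    then have "x = x'" "y = y'" by auto
    then show "\<gamma> = \<gamma>' \<and> \<sigma> = \<sigma>'" by (simp add: xy)
  qed
  have img: "(snd \<circ> snd) ` ?S = permutations N"
  proof (intro equalityI subsetI)
    fix \<pi> assume \<pi>: "\<pi> \<in> permutations N"
    have "\<exists>x y. x \<in> {1..<N} \<and> y \<in> {..<N} \<and> ((\<pi> j - 1) * x + y) mod N = a i \<and> ((\<pi> k - 1) * x + y) mod N = b i" for i
    proof -
      have "(a i, b i) \<in> {(a, b). a < N \<and> b < N \<and> a \<noteq> b}"
        using ab by (simp add: separated_cells_def cells_def)
      then obtain v where "v \<in> {1..<N} \<times> {..<N}"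
          "(a i, b i) = (case v of (x, y) \<Rightarrow> (((\<pi> j - 1) * x + y) mod N, ((\<pi> k - 1) * x + y) mod N))"
        unfolding bij_betw_imp_surj_on[OF bij[OF \<pi> \<pi> \<pi>], symmetric] by blast
      then show ?thesis
        by (intro exI[of _ "fst v"] exI[of _ "snd v"]) (simp add: split_beta mem_Times_iff)
    qed
    then obtain x y where xy: "\<And>i. x i \<in> {1..<N}" "\<And>i. y i \<in> {..<N}"
      "\<And>i. ((\<pi> j - 1) * x i + y i) mod N = a i" "\<And>i. ((\<pi> k - 1) * x i + y i) mod N = b i"
      by metis
    have "(grid_vector N x, grid_vector N y, \<pi>) \<in> ?S"
      using xy \<pi> N1 by (auto simp: lattice_cell_def grid_eq_image grid_nonzero_eq_image)
    then show "\<pi> \<in> (snd \<circ> snd) ` ?S" by force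
  qed auto
  show ?thesis
    using card_image[OF inj] unfolding img by (rule sym)
qed

lemma lattice_cells_separated:
  assumes N: "prime N" and jk: "j \<in> {1..N}" "k \<in> {1..N}" "j \<noteq> k"
    and w: "w \<in> grid_nonzero N \<times> grid N \<times> permutations N"
  shows "(lattice_cell N j w, lattice_cell N k w :: 'd::finite \<Rightarrow> nat) \<in> separated_cells N"
proof -
  have N1: "N \<ge> 1" using N by (rule prime_ge_1_nat)
  obtain x y \<pi> where xy: "w = (grid_vector N x, grid_vector N y, \<pi>)"
      "\<And>i. x i \<in> {1..<N}" "\<And>i. y i \<in> {..<N}" and \<pi>: "\<pi> \<in> permutations N"
    using w unfolding grid_eq_image grid_nonzero_eq_image by blast
  have "\<pi> j \<in> {1..N}" "\<pi> k \<in> {1..N}" "\<pi> j \<noteq> \<pi> k"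
    using permutations_in[OF \<pi>] permutations_neq[OF \<pi>] jk by auto
  then have "\<pi> j - 1 < N" "\<pi> k - 1 < N" "\<pi> j - 1 \<noteq> \<pi> k - 1" by auto
  note bij = lattice_pair_bij[OF N this]
  have "(((\<pi> j - 1) * x i + y i) mod N, ((\<pi> k - 1) * x i + y i) mod N) \<in> {(a, b). a < N \<and> b < N \<and> a \<noteq> b}" for i
    using bij_betw_apply[OF bij, of "(x i, y i)"] xy(2,3)[of i] by (simp only: mem_Times_iff fst_conv snd_conv prod.case simp_thms)
  then show ?thesis
    using N1 by (simp add: xy lattice_cell_def separated_cells_def cells_def)
qed

text \<open>Reduction modulo one has an effect only if the jitter leaves its cube, which happens with
  probability zero. Keeping it makes the description of the nodes hold at every sample point.\<close>
lemma uniform_jittered_cell: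
  fixes c :: "'d::finite \<Rightarrow> nat"
  assumes N: "N \<ge> 1" and c: "c \<in> cells N"
    and J: "uniform_lebesgue M (half_open_cube (1 / real N)) J"
  shows "uniform_lebesgue M (cell N c) (\<lambda>\<omega>. vec_frac (grid_vector N c + J \<omega>))"
proof (rule uniform_lebesgue_cong_AE)
  show "uniform_lebesgue M (cell N c) (\<lambda>\<omega>. grid_vector N c + 1 *\<^sub>R J \<omega>)"
    by (rule uniform_lebesgue_affine[OF J])
       (simp_all add: grid_vector_def cell_eq_translate[OF N])
  have J_meas [measurable]: "J \<in> borel_measurable M"
    and J_distr: "distr M borel J = uniform_measure lborel (half_open_cube (1 / real N))"
    using J by (auto simp: uniform_lebesgue_def)
  show "(\<lambda>\<omega>. vec_frac (grid_vector N c + J \<omega>)) \<in> borel_measurable M" by measurable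
  have "AE x in uniform_measure lborel (half_open_cube (1 / real N)). x \<in> half_open_cube (1 / real N)"
    by (rule AE_uniform_measureI) simp_all
  then have "AE x in distr M borel J. x \<in> half_open_cube (1 / real N)"
    by (simp only: J_distr)
  then have "AE \<omega> in M. J \<omega> \<in> half_open_cube (1 / real N)"
    by (rule AE_distrD[OF J_meas])
  then show "AE \<omega> in M. grid_vector N c + 1 *\<^sub>R J \<omega> = vec_frac (grid_vector N c + J \<omega>)"
  proof eventually_elim
    fix \<omega> assume "J \<omega> \<in> half_open_cube (1 / real N)"
    then have "grid_vector N c + J \<omega> \<in> cell N c"
      by (simp add: grid_vector_def cell_eq_translate[OF N])
    then have "grid_vector N c + J \<omega> \<in> half_open_cube 1"
      using c by (auto simp: half_open_cube_eq_UN_cell[OF N])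
    then have "frac ((grid_vector N c + J \<omega>) $ i) = (grid_vector N c + J \<omega>) $ i" for i
      unfolding half_open_cube_def frac_eq by blast
    then show "grid_vector N c + 1 *\<^sub>R J \<omega> = vec_frac (grid_vector N c + J \<omega>)"
      by (simp add: vec_eq_iff vec_frac_nth)
  qed
qed

text \<open>The discrete variable consists of generator, shift and permutation; the position in the cell is
  given by the jitter.\<close>
lemma rsj_lattice_design:
  fixes p :: "nat \<Rightarrow> 'w \<Rightarrow> real ^ 'd::finite"
  assumes "prob_space M" and N: "prime N" and rsj: "rsj_lattice M N p"
  shows "\<exists>A (W :: 'w \<Rightarrow> (real ^ 'd) \<times> (real ^ 'd) \<times> (nat \<Rightarrow> nat)) \<kappa> cell_of X.
    jittered_design M N A W \<kappa> cell_of X p"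
proof -
  interpret prob_space M by fact
  have N1: "N \<ge> 1" using N by (rule prime_ge_1_nat)
  from rsj obtain g S :: "'w \<Rightarrow> real ^ 'd" and J :: "nat \<Rightarrow> 'w \<Rightarrow> real ^ 'd" and \<pi> :: "'w \<Rightarrow> nat \<Rightarrow> nat"
    where g: "uniform_finite M (grid_nonzero N) g" and S: "uniform_finite M (grid N) S"
      and J: "\<And>j. j \<in> {1..N} \<Longrightarrow> uniform_lebesgue M (half_open_cube (1 / real N)) (J j)"
      and \<pi>: "uniform_finite M (permutations N) \<pi>"
      and ind: "indep_sets (\<lambda>s. case s of
             Generator \<Rightarrow> rv_events M (count_space (grid_nonzero N)) g
           | Shift \<Rightarrow> rv_events M (count_space (grid N)) S
           | Jitter j \<Rightarrow> rv_events M borel (J j)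
           | Permutation \<Rightarrow> rv_events M (count_space (permutations N)) \<pi>)
          ({Generator, Shift, Permutation} \<union> Jitter ` {1..N})" (is "indep_sets ?E ?I")
      and p: "\<And>j \<omega>. j \<in> {1..N} \<Longrightarrow> \<omega> \<in> space M \<Longrightarrow>
           p j \<omega> = vec_frac (lattice_point (g \<omega>) (\<pi> \<omega> j) + S \<omega> + J j \<omega>)"
    unfolding rsj_lattice_def by blast
  note g' = uniform_finite_event[OF g finite_grid_nonzero]
  note S' = uniform_finite_event[OF S finite_grid]
  note \<pi>' = uniform_finite_event[OF \<pi> finite_permutations_upto]
  define A :: "((real ^ 'd) \<times> (real ^ 'd) \<times> (nat \<Rightarrow> nat)) set"
    where "A = grid_nonzero N \<times> grid N \<times> permutations N"
  define W where "W \<omega> = (g \<omega>, S \<omega>, \<pi> \<omega>)" for \<omega>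
  define \<kappa> where "\<kappa> = (1 / real (card (grid_nonzero N :: (real ^ 'd) set)))
    * ((1 / real (card (grid N :: (real ^ 'd) set))) * (1 / real (card (permutations N))))"
  define X where "X j c \<omega> = vec_frac (grid_vector N c + J j \<omega>)" for j c \<omega>
  have "jittered_design M N A W \<kappa> (lattice_cell N) X p"
  proof unfold_locales
    show "N \<ge> 1" by fact
    show "finite A" by (simp add: A_def)
    show W_A: "W \<omega> \<in> A" if "\<omega> \<in> space M" for \<omega>
      using g'(1) S'(1) \<pi>'(1) that by (simp add: A_def W_def)
    show "{\<omega> \<in> space M. W \<omega> = w} \<in> events" if "w \<in> A" for w
    proof -
      obtain \<gamma> \<sigma> \<rho> where w: "w = (\<gamma>, \<sigma>, \<rho>)" by (cases w)
      have "{\<omega> \<in> space M. W \<omega> = w} = {\<omega> \<in> space M. g \<omega> = \<gamma>} \<inter> ({\<omega> \<in> space M. S \<omega> = \<sigma>} \<inter> {\<omega> \<in> space M. \<pi> \<omega> = \<rho>})"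
        by (auto simp: W_def w)
      also have "\<dots> \<in> events"
        using that by (intro sets.Int g'(2) S'(2) \<pi>'(2)) (auto simp: A_def w)
      finally show ?thesis .
    qed
    show "uniform_lebesgue M (cell N c) (X j c)" if "j \<in> {1..N}" "c \<in> cells N" for j c
      unfolding X_def using uniform_jittered_cell[OF N1 that(2) J[OF that(1)]] .
    show "prob {\<omega> \<in> space M. W \<omega> = w \<and> (\<forall>j\<in>K. X j (z j) \<omega> \<in> P j)}
        = \<kappa> * (\<Prod>j\<in>K. prob {\<omega> \<in> space M. X j (z j) \<omega> \<in> P j})"
      if K: "K \<subseteq> {1..N}" and w: "w \<in> A" and P: "\<And>j. j \<in> K \<Longrightarrow> P j \<in> sets borel" for K w z P
    proof -
      obtain \<gamma> \<sigma> \<rho> where w': "w = (\<gamma>, \<sigma>, \<rho>)" by (cases w)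
      have mem: "\<gamma> \<in> grid_nonzero N" "\<sigma> \<in> grid N" "\<rho> \<in> permutations N"
        using w by (auto simp: A_def w')
      let ?e = "\<lambda>s. case s of Generator \<Rightarrow> {\<omega> \<in> space M. g \<omega> = \<gamma>} | Shift \<Rightarrow> {\<omega> \<in> space M. S \<omega> = \<sigma>}
        | Jitter j \<Rightarrow> {\<omega> \<in> space M. X j (z j) \<omega> \<in> P j} | Permutation \<Rightarrow> {\<omega> \<in> space M. \<pi> \<omega> = \<rho>}"
      let ?I = "insert Generator (insert Shift (insert Permutation (Jitter ` K)))"
      have K_fin: "finite K" using K finite_subset by blast
      have XP: "{\<omega> \<in> space M. X j (z j) \<omega> \<in> P j} \<in> rv_events M borel (J j)" if "j \<in> K" for j
      proof -
        have "(\<lambda>x. vec_frac (grid_vector N (z j) + x)) \<in> borel_measurable borel" by measurable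
        from measurable_sets[OF this P[OF that]]
        have "(\<lambda>x. vec_frac (grid_vector N (z j) + x)) -` P j \<in> sets borel" by simp
        moreover have "{\<omega> \<in> space M. X j (z j) \<omega> \<in> P j}
            = J j -` ((\<lambda>x. vec_frac (grid_vector N (z j) + x)) -` P j) \<inter> space M"
          by (auto simp: X_def)
        ultimately show ?thesis unfolding rv_events_def by blast
      qed
      have "{\<omega> \<in> space M. W \<omega> = w \<and> (\<forall>j\<in>K. X j (z j) \<omega> \<in> P j)} = (\<Inter>s\<in>?I. ?e s)"
        by (auto simp: W_def w')
      also have "prob \<dots> = (\<Prod>s\<in>?I. prob (?e s))"
        using K K_fin mem g'(4) S'(4) \<pi>'(4) XP by (intro indep_setsD[OF ind]) auto
      also have "\<dots> = prob (?e Generator) * (prob (?e Shift) * (prob (?e Permutation) * (\<Prod>s\<in>Jitter ` K. prob (?e s))))"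
        using K_fin by (simp add: image_iff)
      also have "(\<Prod>s\<in>Jitter ` K. prob (?e s)) = (\<Prod>j\<in>K. prob {\<omega> \<in> space M. X j (z j) \<omega> \<in> P j})"
        by (subst prod.reindex) (auto simp: inj_on_def)
      finally show ?thesis
        using mem by (simp add: g'(3) S'(3) \<pi>'(3) \<kappa>_def)
    qed
    show "p j \<omega> = X j (lattice_cell N j (W \<omega>)) \<omega>" if "j \<in> {1..N}" "\<omega> \<in> space M" for j \<omega>
      unfolding p[OF that] X_def W_def
      using g'(1) S'(1) that by (intro lattice_node_eq[OF N1]) auto
    show "lattice_cell N j w \<in> cells N" if "w \<in> A" for j w
      using N1 by (auto simp: lattice_cell_def cells_def split: prod.split)
    show "(lattice_cell N j w, lattice_cell N k w) \<in> separated_cells N"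
      if "j \<in> {1..N}" "k \<in> {1..N}" "j \<noteq> k" "w \<in> A" for j k w
      using lattice_cells_separated[OF N that(1-3)] that(4) by (simp add: A_def)
    show "card {w \<in> A. lattice_cell N j w = a \<and> lattice_cell N k w = b}
        = card {w \<in> A. lattice_cell N j w = a' \<and> lattice_cell N k w = b'}"
      if "j \<in> {1..N}" "k \<in> {1..N}" "j \<noteq> k" "(a, b) \<in> separated_cells N" "(a', b') \<in> separated_cells N"
      for j k a b a' b'
      using card_lattice_sources[OF N that(1-4)] card_lattice_sources[OF N that(1-3,5)] by (simp add: A_def)
  qed
  then show ?thesis by blast
qed

section \<open>Comparison with Monte Carlo\<close>

theorem corollary3p5:
  fixes M :: "'w measure" and M' :: "'v measure"
    and N :: nat
    and f :: "real ^ 'd \<Rightarrow> real"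
    and p :: "nat \<Rightarrow> 'w \<Rightarrow> real ^ 'd" and u :: "nat \<Rightarrow> 'v \<Rightarrow> real ^ 'd"
  assumes "prob_space M" and "prob_space M'"
    and "N \<ge> 1"
    and "square_integrable_on (half_open_cube 1) f"
    and "monotone_in_each_coordinate_on (half_open_cube 1) f"
    and "(prime N \<and> rsj_lattice M N p) \<or> latin_hypercube_sample M N p"
    and "monte_carlo_sample M' N u"
  shows "completed_variance M (quadrature N p f) \<le> completed_variance M' (quadrature N u f)"
proof -
  note compare = variance_le_monte_carlo_if_separated_pairs[OF assms(1-5) _ _ assms(7)]
  from assms(6) show ?thesis
  proof
    assume "prime N \<and> rsj_lattice M N p"
    then obtain A and W :: "'w \<Rightarrow> (real ^ 'd) \<times> (real ^ 'd) \<times> (nat \<Rightarrow> nat)" and \<kappa> cell_of X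
      where "jittered_design M N A W \<kappa> cell_of X p"
      using rsj_lattice_design[OF assms(1)] by blast
    then interpret jittered_design M N A W \<kappa> cell_of X p .
    show ?thesis by (rule compare[OF node_uniform node_pair_uniform])
  next
    assume "latin_hypercube_sample M N p"
    then obtain A and W :: "'w \<Rightarrow> 'd \<Rightarrow> nat \<Rightarrow> nat" and \<kappa> cell_of X
      where "jittered_design M N A W \<kappa> cell_of X p"
      using latin_hypercube_design[OF assms(1,3)] by blast
    then interpret jittered_design M N A W \<kappa> cell_of X p .
    show ?thesis by (rule compare[OF node_uniform node_pair_uniform])
  qed
qed

end
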